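(* Let $\alpha>1/2$, $\mu>1$, let $\boldsymbol{\gamma}=(\gamma_j)_{j\in\mathbb{N}}$ be a sequence of positive real numbers, and let $\kappa$ be a real number with $\kappa\ge\max\{\exp(\mathrm{e}^2),\exp(\mathrm{e}^2\gamma_j^{1/\mu})\}$ for all $j\in\mathbb{N}$. Then, for the integration problem in the Korobov spaces $H_{K_{\alpha,\boldsymbol{\gamma}}}$ and likewise for the integration problem in the $\log$-Korobov spaces $H_{K_{\log,\mu,\boldsymbol{\gamma}}}$: (1) strong polynomial QMC-tractability holds if and only if $\sum_{j=1}^\infty\gamma_j<\infty$; (2) polynomial QMC-tractability holds if and only if $\limsup_{s\to\infty}\frac{\sum_{j=1}^s\gamma_j}{\log s}<\infty$; (3) weak QMC-tractability holds if and only if $\lim_{s\to\infty}\frac{\sum_{j=1}^s\gamma_j}{s}=0$.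
   Context: $\log$ denotes the natural logarithm. Spaces. For $k\in\mathbb{Z}$ let $w_{\alpha,\gamma}(0)=1$, $w_{\alpha,\gamma}(k)=\gamma|k|^{-2\alpha}$ for $k\ne0$, and $r_{\mu,\gamma}(0)=1$, $r_{\mu,\gamma}(k)=\gamma|k|^{-1}(\log(\kappa|k|))^{-\mu}$ for $k\neq0$. For $\boldsymbol{k}\in\mathbb{Z}^s$ put $w_{\alpha,\boldsymbol{\gamma}}(\boldsymbol{k})=\prod_{j=1}^sw_{\alpha,\gamma_j}(k_j)$ and $r_{\mu,\boldsymbol{\gamma}}(\boldsymbol{k})=\prod_{j=1}^sr_{\mu,\gamma_j}(k_j)$. In dimension $s$, the Korobov space $H_{K_{\alpha,\boldsymbol{\gamma}}}$ and the $\log$-Korobov space $H_{K_{\log,\mu,\boldsymbol{\gamma}}}$ are the reproducing kernel Hilbert spaces of functions on $[0,1]^s$ with kernels $K_{\alpha,\boldsymbol{\gamma}}(\boldsymbol{x},\boldsymbol{y})=\sum_{\boldsymbol{k}\in\mathbb{Z}^s}w_{\alpha,\boldsymbol{\gamma}}(\boldsymbol{k})\mathrm{e}^{2\pi\mathrm{i}\boldsymbol{k}\cdot(\boldsymbol{x}-\boldsymbol{y})}$ and $K_{\log,\mu,\boldsymbol{\gamma}}(\boldsymbol{x},\boldsymbol{y})=\sum_{\boldsymbol{k}\in\mathbb{Z}^s}r_{\mu,\boldsymbol{\gamma}}(\boldsymbol{k})\mathrm{e}^{2\pi\mathrm{i}\boldsymbol{k}\cdot(\boldsymbol{x}-\boldsymbol{y})}$;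 their inner products are $\sum_{\boldsymbol{k}}\widehat f(\boldsymbol{k})\overline{\widehat g(\boldsymbol{k})}w_{\alpha,\boldsymbol{\gamma}}^{-1}(\boldsymbol{k})$ and $\sum_{\boldsymbol{k}}\widehat f(\boldsymbol{k})\overline{\widehat g(\boldsymbol{k})}r_{\mu,\boldsymbol{\gamma}}^{-1}(\boldsymbol{k})$ respectively, where $\widehat f(\boldsymbol{k})=\int_{[0,1]^s}f(\boldsymbol{x})\mathrm{e}^{-2\pi\mathrm{i}\boldsymbol{k}\cdot\boldsymbol{x}}\,\mathrm{d}\boldsymbol{x}$. Errors. For a Hilbert space $H$ of functions on $[0,1]^s$ and an $N$-element point set (repetitions allowed) $P=\{\boldsymbol{x}_0,\ldots,\boldsymbol{x}_{N-1}\}\subseteq[0,1]^s$, $e(H,P)=\sup_{\|f\|_H\le1}\left|\int_{[0,1]^s}f(\boldsymbol{x})\,\mathrm{d}\boldsymbol{x}-\frac1N\sum_{n=0}^{N-1}f(\boldsymbol{x}_n)\right|$. Given one space $H$ for each dimension $s$, let $e(N,s)=\inf_Pe(H,P)$ over all $N$-element point sets $P$ in $[0,1]^s$, let $e(0,s)=\sup_{\|f\|_H\le1}\left|\int_{[0,1]^s}f(\boldsymbol{x})\,\mathrm{d}\boldsymbol{x}\right|$ be the initial error, and for $\varepsilon\in(0,1)$ let $N_{\min}(\varepsilon,s)=\min\{N\in\mathbb{N}:e(N,s)\le\varepsilon\,e(0,s)\}$. Tractability. The integration problem in $H$ is weakly QMC-tractable if $\lim_{s+\varepsilon^{-1}\to\infty}\frac{\log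 N_{\min}(\varepsilon,s)}{s+\varepsilon^{-1}}=0$; polynomially QMC-tractable if there exist non-negative $c,p,q$ such that $N_{\min}(\varepsilon,s)\le c\,s^q\varepsilon^{-p}$ for all $\varepsilon\in(0,1)$ and $s\in\mathbb{N}$; strongly polynomially QMC-tractable if this holds with $q=0$. *)

theory Defs
  imports "HOL-Probability.Probability"
begin

subsection \<open>Reproducing kernel Hilbert spaces\<close>

text \<open>
  Functions on a set \<open>X\<close> are total functions that vanish outside \<open>X\<close>. In this way the functions
  on \<open>X\<close> form a linear space under the pointwise operations of the whole type.
\<close>

record 'x fun_space =
  fns :: "('x \<Rightarrow> complex) set"
  ip :: "('x \<Rightarrow> complex) \<Rightarrow> ('x \<Rightarrow> complex) \<Rightarrow> complex"

definition hnorm :: "'x fun_space \<Rightarrow> ('x \<Rightarrow> complex) \<Rightarrow> real" where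
  "hnorm H f = sqrt (Re (ip H f f))"

locale function_hilbert_space =
  fixes X :: "'x set" and H :: "'x fun_space"
  assumes support: "f \<in> fns H \<Longrightarrow> x \<notin> X \<Longrightarrow> f x = 0"
    and zero_closed: "(\<lambda>x. 0) \<in> fns H"
    and add_closed: "f \<in> fns H \<Longrightarrow> g \<in> fns H \<Longrightarrow> (\<lambda>x. f x + g x) \<in> fns H"
    and scale_closed: "f \<in> fns H \<Longrightarrow> (\<lambda>x. c * f x) \<in> fns H"
    and ip_add: "f \<in> fns H \<Longrightarrow> g \<in> fns H \<Longrightarrow> h \<in> fns H \<Longrightarrow>
      ip H (\<lambda>x. f x + g x) h = ip H f h + ip H g h"
    and ip_scale: "f \<in> fns H \<Longrightarrow> g \<in> fns H \<Longrightarrow> ip H (\<lambda>x. c * f x) g = c * ip H f g"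
    and ip_commute: "f \<in> fns H \<Longrightarrow> g \<in> fns H \<Longrightarrow> ip H g f = cnj (ip H f g)"
    and ip_nonneg: "f \<in> fns H \<Longrightarrow> Re (ip H f f) \<ge> 0"
    and ip_definite: "f \<in> fns H \<Longrightarrow> ip H f f = 0 \<Longrightarrow> f = (\<lambda>x. 0)"
    and complete: "(\<And>n. F n \<in> fns H) \<Longrightarrow>
      (\<And>e. e > 0 \<Longrightarrow> \<exists>M. \<forall>m\<ge>M. \<forall>n\<ge>M. hnorm H (\<lambda>x. F m x - F n x) < e) \<Longrightarrow>
      \<exists>f\<in>fns H. (\<lambda>n. hnorm H (\<lambda>x. F n x - f x)) \<longlonglongrightarrow> 0"

definition kernel_section :: "'x set \<Rightarrow> ('x \<Rightarrow> 'x \<Rightarrow> complex) \<Rightarrow> 'x \<Rightarrow> 'x \<Rightarrow> complex" where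
  "kernel_section X K y = (\<lambda>x. if x \<in> X then K x y else 0)"

text \<open>For given \<open>X\<close> and \<open>K\<close>, these assumptions determine the set of functions and the inner
  product on it uniquely; existence for positive definite \<open>K\<close> is the Moore-Aronszajn theorem.\<close>

locale rkhs = function_hilbert_space X H
  for X :: "'x set" and K :: "'x \<Rightarrow> 'x \<Rightarrow> complex" and H :: "'x fun_space" +
  assumes section_closed: "y \<in> X \<Longrightarrow> kernel_section X K y \<in> fns H"
    and reproducing: "f \<in> fns H \<Longrightarrow> y \<in> X \<Longrightarrow> f y = ip H f (kernel_section X K y)"


subsection \<open>Korobov and log-Korobov kernels\<close>

text \<open>Coordinates of \<open>s\<close>-dimensional vectors are indexed by \<open>{..<s}\<close>, so that \<open>\<gamma> j\<close> is the
  weight of the \<open>(j+1)\<close>-st coordinate.\<close>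

definition unit_cube :: "nat \<Rightarrow> (nat \<Rightarrow> real) set" where
  "unit_cube s = (\<Pi>\<^sub>E j\<in>{..<s}. {0..1})"

definition cube_measure :: "nat \<Rightarrow> (nat \<Rightarrow> real) measure" where
  "cube_measure s = (\<Pi>\<^sub>M j\<in>{..<s}. restrict_space lborel {0..1})"

definition int_vectors :: "nat \<Rightarrow> (nat \<Rightarrow> int) set" where
  "int_vectors s = (\<Pi>\<^sub>E j\<in>{..<s}. UNIV)"

definition korobov_weight :: "real \<Rightarrow> real \<Rightarrow> int \<Rightarrow> real" where
  "korobov_weight \<alpha> g k = (if k = 0 then 1 else g * \<bar>real_of_int k\<bar> powr (- 2 * \<alpha>))"

definition log_korobov_weight :: "real \<Rightarrow> real \<Rightarrow> real \<Rightarrow> int \<Rightarrow> real" where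
  "log_korobov_weight \<kappa> \<mu> g k =
    (if k = 0 then 1 else g * inverse \<bar>real_of_int k\<bar> * ln (\<kappa> * \<bar>real_of_int k\<bar>) powr (- \<mu>))"

definition fourier_kernel ::
    "(nat \<Rightarrow> int \<Rightarrow> real) \<Rightarrow> nat \<Rightarrow> (nat \<Rightarrow> real) \<Rightarrow> (nat \<Rightarrow> real) \<Rightarrow> complex" where
  "fourier_kernel w s x y =
    (\<Sum>\<^sub>\<infinity>k\<in>int_vectors s. complex_of_real (\<Prod>j<s. w j (k j)) *
      exp (2 * pi * \<i> * complex_of_real (\<Sum>j<s. real_of_int (k j) * (x j - y j))))"

definition korobov_kernel ::
    "real \<Rightarrow> (nat \<Rightarrow> real) \<Rightarrow> nat \<Rightarrow> (nat \<Rightarrow> real) \<Rightarrow> (nat \<Rightarrow> real) \<Rightarrow> complex" where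
  "korobov_kernel \<alpha> \<gamma> = fourier_kernel (\<lambda>j. korobov_weight \<alpha> (\<gamma> j))"

definition log_korobov_kernel ::
    "real \<Rightarrow> real \<Rightarrow> (nat \<Rightarrow> real) \<Rightarrow> nat \<Rightarrow> (nat \<Rightarrow> real) \<Rightarrow> (nat \<Rightarrow> real) \<Rightarrow> complex" where
  "log_korobov_kernel \<kappa> \<mu> \<gamma> = fourier_kernel (\<lambda>j. log_korobov_weight \<kappa> \<mu> (\<gamma> j))"


subsection \<open>Worst-case errors and QMC-tractability\<close>

text \<open>In this part \<open>H\<close> assigns to every dimension \<open>s \<ge> 1\<close> a space of functions on the unit cube.
  Errors take values in \<^typ>\<open>ennreal\<close> so that suprema are meaningful without side conditions.
  A point set with repetitions is a tuple \<open>P\<close>, of which only \<open>P 0, \<dots>, P (N - 1)\<close> matter.\<close>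

definition qmc_error ::
    "(nat \<Rightarrow> real) fun_space \<Rightarrow> nat \<Rightarrow> nat \<Rightarrow> (nat \<Rightarrow> nat \<Rightarrow> real) \<Rightarrow> ennreal" where
  "qmc_error H s N P = (SUP f\<in>{f \<in> fns H. hnorm H f \<le> 1}.
     ennreal (norm ((\<integral>x. f x \<partial>cube_measure s) - (1 / of_nat N) * (\<Sum>n<N. f (P n)))))"

definition min_error :: "(nat \<Rightarrow> (nat \<Rightarrow> real) fun_space) \<Rightarrow> nat \<Rightarrow> nat \<Rightarrow> ennreal" where
  "min_error H N s = (INF P\<in>{..<N} \<rightarrow> unit_cube s. qmc_error (H s) s N P)"

definition initial_error :: "(nat \<Rightarrow> (nat \<Rightarrow> real) fun_space) \<Rightarrow> nat \<Rightarrow> ennreal" where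
  "initial_error H s = (SUP f\<in>{f \<in> fns (H s). hnorm (H s) f \<le> 1}.
     ennreal (norm (\<integral>x. f x \<partial>cube_measure s)))"

definition N_min :: "(nat \<Rightarrow> (nat \<Rightarrow> real) fun_space) \<Rightarrow> real \<Rightarrow> nat \<Rightarrow> nat" where
  "N_min H \<epsilon> s = (LEAST N. N \<ge> 1 \<and> min_error H N s \<le> ennreal \<epsilon> * initial_error H s)"

definition weakly_QMC_tractable :: "(nat \<Rightarrow> (nat \<Rightarrow> real) fun_space) \<Rightarrow> bool" where
  "weakly_QMC_tractable H \<longleftrightarrow>
    ((\<lambda>(s, \<epsilon>). ln (real (N_min H \<epsilon> s)) / (real s + inverse \<epsilon>)) \<longlongrightarrow> 0)
      (inf (filtercomap (\<lambda>(s, \<epsilon>). real s + inverse \<epsilon>) at_top)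
        (principal ({1..} \<times> {0<..<1})))"

definition N_min_bound ::
    "(nat \<Rightarrow> (nat \<Rightarrow> real) fun_space) \<Rightarrow> real \<Rightarrow> real \<Rightarrow> real \<Rightarrow> bool" where
  "N_min_bound H c p q \<longleftrightarrow>
    (\<forall>\<epsilon>\<in>{0<..<1}. \<forall>s\<ge>1. real (N_min H \<epsilon> s) \<le> c * real s powr q * \<epsilon> powr (- p))"

definition polynomially_QMC_tractable :: "(nat \<Rightarrow> (nat \<Rightarrow> real) fun_space) \<Rightarrow> bool" where
  "polynomially_QMC_tractable H \<longleftrightarrow> (\<exists>c\<ge>0. \<exists>p\<ge>0. \<exists>q\<ge>0. N_min_bound H c p q)"

definition strongly_polynomially_QMC_tractable ::
    "(nat \<Rightarrow> (nat \<Rightarrow> real) fun_space) \<Rightarrow> bool" where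
  "strongly_polynomially_QMC_tractable H \<longleftrightarrow> (\<exists>c\<ge>0. \<exists>p\<ge>0. N_min_bound H c p 0)"

end

theory Submission
  imports Defs "HOL-Real_Asymp.Real_Asymp"
begin

text \<open>
  Everything follows from the two-sided estimate
  \<open>exp (c * S) / 2 \<le> N_min(\<epsilon>, s) \<le> 2 * exp (C * S) / \<epsilon>\<^sup>2\<close> for \<open>\<epsilon> \<in> (0, 1)\<close>, where
  \<open>S = \<gamma>\<^sub>0 + \<dots> + \<gamma>\<^bsub>s-1\<^esub>\<close> and the constants \<open>c > 0\<close> and \<open>C \<ge> 0\<close> depend neither on \<open>s\<close> nor on \<open>\<epsilon>\<close>
  (\<open>N_min_bounds\<close>). The three notions of tractability compare \<open>N_min\<close> with a constant, a power of
  \<open>s\<close> and a subexponential function of \<open>s\<close>, hence \<open>S\<close> with a constant, with \<open>ln s\<close> and with \<open>s\<close>.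

  Sections \<open>K(\<cdot>, y)\<close> of the kernel have mean \<open>1\<close>. Therefore the constant function \<open>1\<close> lies in the
  space and represents integration (\<open>one_closed\<close>, \<open>ip_one\<close>), the initial error is \<open>1\<close>, and the
  squared worst-case error of nodes \<open>x\<^sub>0, \<dots>, x\<^bsub>N-1\<^esub>\<close> is \<open>N\<^sup>-\<^sup>2 \<Sum>\<^bsub>n,m\<^esub> K(x\<^sub>n, x\<^sub>m) - 1\<close>
  (\<open>SUP_integration_error\<close>).

  For the upper bound, each new node \<open>x\<close> is taken such that the sum of \<open>K(x, x\<^sub>n) - 1\<close> over the previous
  nodes is at most its mean, which is zero (\<open>greedy_points\<close>). The squared error is then at most
  \<open>K(0,0) / N\<close>, and \<open>K(0,0)\<close> is a product of \<open>s\<close> factors, each at most \<open>1 + C * \<gamma>\<^sub>j\<close>.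

  For the lower bound, the squared error equals \<open>\<Sum>\<^sub>k w(k) \<bar>N\<^sup>-\<^sup>1 \<Sum>\<^sub>n e(k \<cdot> x\<^sub>n)\<bar>\<^sup>2 - 1\<close> with
  \<open>e(t) = exp (2 \<pi> i t)\<close>, so it only decreases if the weights are made smaller. Keeping in each
  coordinate only the frequencies \<open>-1\<close>, \<open>0\<close>, \<open>1\<close>, with weights \<open>c * \<gamma>\<^sub>j\<close>, \<open>1\<close>, \<open>c * \<gamma>\<^sub>j\<close> and
  \<open>c * \<gamma>\<^sub>j \<le> 1 / 2\<close>, one is left with the nonnegative kernel
  \<open>\<Prod>\<^sub>j (1 + 2 * c * \<gamma>\<^sub>j * cos (2 \<pi> (x\<^sub>j - y\<^sub>j)))\<close>. The \<open>N\<close> diagonal terms alone give a squared error of at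
  least \<open>(\<Prod>\<^sub>j (1 + 2 * c * \<gamma>\<^sub>j)) / N - 1\<close> (\<open>sum_kernel_ge_diagonal\<close>). A constant \<open>c\<close> that serves all
  coordinates exists because the condition on \<open>\<kappa>\<close> bounds the sequence \<open>\<gamma>\<close>.

  Both families of spaces have coordinate weights \<open>\<gamma>\<^sub>j v(k)\<close> for \<open>k \<noteq> 0\<close> with a summable function \<open>v\<close>
  that is positive at \<open>1\<close> and \<open>-1\<close>, so one argument covers them (\<open>weighted_integration_product\<close>).
\<close>

section \<open>Hilbert spaces of functions\<close>

context function_hilbert_space
begin

lemma ip_add_right:
  assumes "f \<in> fns H" "g \<in> fns H" "h \<in> fns H"
  shows "ip H h (\<lambda>x. f x + g x) = ip H h f + ip H h g"
  using assms ip_add ip_commute[OF assms(1) assms(3)] ip_commute[OF assms(2) assms(3)]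
    ip_commute[OF add_closed[OF assms(1,2)] assms(3)] by simp

lemma ip_scale_right:
  assumes "f \<in> fns H" "g \<in> fns H"
  shows "ip H g (\<lambda>x. c * f x) = cnj c * ip H g f"
  using assms ip_scale ip_commute[OF assms] ip_commute[OF scale_closed[OF assms(1)] assms(2)]
  by simp

lemma diff_closed:
  assumes "f \<in> fns H" "g \<in> fns H"
  shows "(\<lambda>x. f x - g x) \<in> fns H"
  using add_closed[OF assms(1) scale_closed[OF assms(2), of "-1"]] by simp

lemma ip_diff:
  assumes "f \<in> fns H" "g \<in> fns H" "h \<in> fns H"
  shows "ip H (\<lambda>x. f x - g x) h = ip H f h - ip H g h"
  using ip_add[OF assms(1) scale_closed[OF assms(2), of "-1"] assms(3)]
    ip_scale[OF assms(2,3), of "-1"] by simp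

lemma ip_diff_right:
  assumes "f \<in> fns H" "g \<in> fns H" "h \<in> fns H"
  shows "ip H h (\<lambda>x. f x - g x) = ip H h f - ip H h g"
  using ip_add_right[OF assms(1) scale_closed[OF assms(2), of "-1"] assms(3)]
    ip_scale_right[OF assms(2,3), of "-1"] by simp

lemma sum_closed:
  assumes "finite A" "\<And>a. a \<in> A \<Longrightarrow> F a \<in> fns H"
  shows "(\<lambda>x. \<Sum>a\<in>A. F a x) \<in> fns H"
  using assms by (induction A rule: finite_induct) (auto intro: zero_closed add_closed)

lemma ip_zero_right: "g \<in> fns H \<Longrightarrow> ip H g (\<lambda>x. 0) = 0"
  using ip_scale_right[OF zero_closed, of g 0] by simp

lemma ip_sum_right:
  assumes "finite A" "\<And>a. a \<in> A \<Longrightarrow> F a \<in> fns H" "g \<in> fns H"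
  shows "ip H g (\<lambda>x. \<Sum>a\<in>A. F a x) = (\<Sum>a\<in>A. ip H g (F a))"
  using assms by (induction A rule: finite_induct)
    (auto simp: ip_zero_right ip_add_right sum_closed)

lemma ip_self: "f \<in> fns H \<Longrightarrow> ip H f f = complex_of_real ((hnorm H f)\<^sup>2)"
  using ip_commute[of f f] ip_nonneg[of f] by (simp add: hnorm_def complex_eq_iff)

lemma hnorm_nonneg: "f \<in> fns H \<Longrightarrow> 0 \<le> hnorm H f"
  by (simp add: hnorm_def ip_nonneg)

lemma hnorm_scale:
  assumes "f \<in> fns H"
  shows "hnorm H (\<lambda>x. c * f x) = norm c * hnorm H f"
proof -
  have "complex_of_real ((hnorm H (\<lambda>x. c * f x))\<^sup>2) = of_real ((norm c * hnorm H f)\<^sup>2)"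
    using assms
    by (simp add: ip_self[symmetric] scale_closed ip_scale ip_scale_right power_mult_distrib
        complex_norm_square del: of_real_power)
  then have "(hnorm H (\<lambda>x. c * f x))\<^sup>2 = (norm c * hnorm H f)\<^sup>2"
    by (simp only: of_real_eq_iff)
  then show ?thesis
    using hnorm_nonneg assms scale_closed by (simp add: power2_eq_iff_nonneg)
qed

lemma hnorm_add_sq:
  assumes "f \<in> fns H" "g \<in> fns H"
  shows "(hnorm H (\<lambda>x. f x + g x))\<^sup>2 = (hnorm H f)\<^sup>2 + 2 * Re (ip H f g) + (hnorm H g)\<^sup>2"
proof -
  have "complex_of_real ((hnorm H (\<lambda>x. f x + g x))\<^sup>2)
      = ip H f f + ip H f g + cnj (ip H f g) + ip H g g"
    using assms by (simp only: ip_self[symmetric] add_closed ip_add ip_add_right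
        ip_commute[of f g]) simp
  then have "Re (complex_of_real ((hnorm H (\<lambda>x. f x + g x))\<^sup>2)) =
      Re (ip H f f + ip H f g + cnj (ip H f g) + ip H g g)" by simp
  then show ?thesis using assms by (simp add: ip_self del: of_real_power)
qed

lemma hnorm_diff_sq:
  assumes "f \<in> fns H" "g \<in> fns H"
  shows "(hnorm H (\<lambda>x. f x - g x))\<^sup>2 = (hnorm H f)\<^sup>2 - 2 * Re (ip H f g) + (hnorm H g)\<^sup>2"
  using hnorm_add_sq[OF assms(1) scale_closed[OF assms(2), of "-1"]]
    hnorm_scale[OF assms(2), of "-1"] ip_scale_right[OF assms(2,1), of "-1"] by simp

text \<open>The quadratic function \<open>t \<mapsto> \<parallel>h + t g\<parallel>\<^sup>2\<close> is evaluated at its minimiser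
  \<open>t = - \<langle>h, g\<rangle> / \<parallel>g\<parallel>\<^sup>2\<close>, where it equals \<open>\<parallel>h\<parallel>\<^sup>2 - \<bar>\<langle>h, g\<rangle>\<bar>\<^sup>2 / \<parallel>g\<parallel>\<^sup>2\<close>.\<close>

lemma orthogonal_if_norm_minimal:
  assumes h: "h \<in> fns H" and g: "g \<in> fns H"
    and min: "\<And>t. hnorm H h \<le> hnorm H (\<lambda>x. h x + t * g x)"
  shows "ip H h g = 0"
proof (cases "hnorm H g = 0")
  case True
  then have "g = (\<lambda>x. 0)" using ip_definite ip_self g by simp
  then show ?thesis using ip_zero_right h by simp
next
  case False
  define t where "t = - ip H h g / of_real ((hnorm H g)\<^sup>2)"
  have "(hnorm H h)\<^sup>2 \<le> (hnorm H (\<lambda>x. h x + t * g x))\<^sup>2"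
    using min[of t] hnorm_nonneg[OF h] by (rule power_mono)
  also have "\<dots> = (hnorm H h)\<^sup>2 + 2 * Re (cnj t * ip H h g) + (norm t * hnorm H g)\<^sup>2"
    by (simp add: hnorm_add_sq hnorm_scale ip_scale_right scale_closed h g)
  also have "Re (cnj t * ip H h g) = - (norm (ip H h g))\<^sup>2 / (hnorm H g)\<^sup>2"
  proof -
    have "cnj t * ip H h g = of_real (- (norm (ip H h g))\<^sup>2 / (hnorm H g)\<^sup>2)"
      by (simp add: t_def complex_norm_square del: of_real_power)
    then show ?thesis by (metis Re_complex_of_real)
  qed
  also have "(norm t * hnorm H g)\<^sup>2 = (norm (ip H h g))\<^sup>2 / (hnorm H g)\<^sup>2"
  proof -
    have "norm t = norm (ip H h g) / (hnorm H g)\<^sup>2"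
      by (simp add: t_def norm_divide del: of_real_power)
    then show ?thesis using False by (simp add: power2_eq_square)
  qed
  finally have "(norm (ip H h g))\<^sup>2 / (hnorm H g)\<^sup>2 \<le> 0" by simp
  then show ?thesis using False by (simp add: divide_le_0_iff)
qed

lemma Cauchy_Schwarz:
  assumes f: "f \<in> fns H" and g: "g \<in> fns H"
  shows "norm (ip H f g) \<le> hnorm H f * hnorm H g"
proof (cases "hnorm H g = 0")
  case True
  then have "g = (\<lambda>x. 0)" using ip_definite ip_self g by simp
  then show ?thesis using ip_zero_right f hnorm_nonneg g by simp
next
  case False
  define c where "c = ip H f g / of_real ((hnorm H g)\<^sup>2)"
  have "0 \<le> (hnorm H (\<lambda>x. f x - c * g x))\<^sup>2" by simp
  also have "\<dots> = (hnorm H f)\<^sup>2 - 2 * Re (cnj c * ip H f g) + (norm c * hnorm H g)\<^sup>2"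
    by (simp add: hnorm_diff_sq hnorm_scale ip_scale_right scale_closed f g)
  also have "Re (cnj c * ip H f g) = (norm (ip H f g))\<^sup>2 / (hnorm H g)\<^sup>2"
  proof -
    have "cnj c * ip H f g = of_real ((norm (ip H f g))\<^sup>2 / (hnorm H g)\<^sup>2)"
      by (simp add: c_def complex_norm_square del: of_real_power)
    then show ?thesis by (metis Re_complex_of_real)
  qed
  also have "(norm c * hnorm H g)\<^sup>2 = (norm (ip H f g))\<^sup>2 / (hnorm H g)\<^sup>2"
  proof -
    have "norm c = norm (ip H f g) / (hnorm H g)\<^sup>2"
      by (simp add: c_def norm_divide del: of_real_power)
    then show ?thesis using False by (simp add: power2_eq_square)
  qed
  finally have "(norm (ip H f g))\<^sup>2 \<le> (hnorm H f * hnorm H g)\<^sup>2"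
    using False by (simp add: field_simps power_mult_distrib)
  then show ?thesis
    using hnorm_nonneg f g by (meson mult_nonneg_nonneg power2_le_imp_le)
qed

lemma hnorm_triangle:
  assumes f: "f \<in> fns H" and g: "g \<in> fns H"
  shows "hnorm H (\<lambda>x. f x + g x) \<le> hnorm H f + hnorm H g"
proof -
  have "Re (ip H f g) \<le> hnorm H f * hnorm H g"
    using Cauchy_Schwarz[OF f g] complex_Re_le_cmod[of "ip H f g"] by linarith
  then have "(hnorm H (\<lambda>x. f x + g x))\<^sup>2 \<le> (hnorm H f + hnorm H g)\<^sup>2"
    using hnorm_add_sq[OF f g] by (simp add: power2_sum)
  then show ?thesis
    using hnorm_nonneg f g by (meson add_nonneg_nonneg power2_le_imp_le)
qed

text \<open>Worst-case errors are suprema of this form. Equality is attained at \<open>g / \<parallel>g\<parallel>\<close>.\<close>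

lemma SUP_unit_ball_ip:
  assumes g: "g \<in> fns H"
  shows "(SUP f\<in>{f \<in> fns H. hnorm H f \<le> 1}. ennreal (norm (ip H f g))) = ennreal (hnorm H g)"
proof (rule antisym)
  show "(SUP f\<in>{f \<in> fns H. hnorm H f \<le> 1}. ennreal (norm (ip H f g))) \<le> ennreal (hnorm H g)"
  proof (rule SUP_least)
    fix f assume f: "f \<in> {f \<in> fns H. hnorm H f \<le> 1}"
    then have "norm (ip H f g) \<le> hnorm H f * hnorm H g" using Cauchy_Schwarz g by blast
    also have "\<dots> \<le> 1 * hnorm H g" using f g hnorm_nonneg by (intro mult_right_mono) auto
    finally show "ennreal (norm (ip H f g)) \<le> ennreal (hnorm H g)" by (simp add: ennreal_leI)
  qed
  show "ennreal (hnorm H g) \<le> (SUP f\<in>{f \<in> fns H. hnorm H f \<le> 1}. ennreal (norm (ip H f g)))"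
  proof (cases "hnorm H g = 0")
    case False
    define f where "f = (\<lambda>x. complex_of_real (1 / hnorm H g) * g x)"
    have f: "f \<in> fns H" "hnorm H f \<le> 1"
      using False hnorm_nonneg[OF g] hnorm_scale[OF g, of "complex_of_real (1 / hnorm H g)"]
        scale_closed[OF g, of "complex_of_real (1 / hnorm H g)"]
      unfolding f_def by (auto simp: norm_divide)
    have "norm (ip H f g) = hnorm H g"
      unfolding f_def ip_scale[OF g g] ip_self[OF g]
      using False hnorm_nonneg[OF g] by (simp add: norm_mult norm_divide power2_eq_square)
    then show ?thesis using f by (intro SUP_upper2[of f]) auto
  qed simp
qed

end

section \<open>Greedy choice of points\<close>

text \<open>Good points are chosen one after the other. Since \<open>\<Sum>\<^bsub>n<N\<^esub> G x (p n)\<close> has mean zero as a function of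
  \<open>x\<close>, it is nonpositive somewhere; taking such an \<open>x\<close> as the next point, only the diagonal entry
  \<open>G x x \<le> B\<close> adds to the double sum. This is a derandomised form of the usual computation with
  independent random points, and it involves single integrals only.\<close>

lemma (in prob_space) greedy_points:
  fixes G :: "'a \<Rightarrow> 'a \<Rightarrow> real"
  assumes sym: "\<And>x y. x \<in> space M \<Longrightarrow> y \<in> space M \<Longrightarrow> G x y = G y x"
    and int: "\<And>y. y \<in> space M \<Longrightarrow> integrable M (\<lambda>x. G x y)"
    and zero: "\<And>y. y \<in> space M \<Longrightarrow> (\<integral>x. G x y \<partial>M) = 0"
    and diag: "\<And>x. x \<in> space M \<Longrightarrow> G x x \<le> B"
  shows "\<exists>p. (\<forall>n. p n \<in> space M) \<and> (\<Sum>n<N. \<Sum>m<N. G (p n) (p m)) \<le> real N * B"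
proof (induction N)
  case 0
  then show ?case using not_empty by (auto intro!: exI[of _ "\<lambda>_. SOME x. x \<in> space M"] simp: some_in_eq)
next
  case (Suc N)
  then obtain p where p: "\<And>n. p n \<in> space M" "(\<Sum>n<N. \<Sum>m<N. G (p n) (p m)) \<le> real N * B"
    by blast
  have "\<exists>x\<in>space M. (\<Sum>n<N. G x (p n)) \<le> 0"
  proof (rule ccontr)
    assume "\<not> ?thesis"
    then have "expectation (\<lambda>x. \<Sum>n<N. G x (p n)) > 0"
      using int p by (intro expectation_greater) (auto simp: not_le)
    then show False using int zero p by (simp add: Bochner_Integration.integral_sum)
  qed
  then obtain x where x: "x \<in> space M" "(\<Sum>n<N. G x (p n)) \<le> 0" by blast
  have "(\<Sum>n<N. G (p n) x) = (\<Sum>n<N. G x (p n))" using sym x p by (intro sum.cong) auto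
  then have "(\<Sum>n<Suc N. \<Sum>m<Suc N. G ((p(N := x)) n) ((p(N := x)) m)) \<le> real (Suc N) * B"
    using p(2) x(2) diag[OF x(1)] by (simp add: sum.distrib algebra_simps)
  then show ?case using p x by (intro exI[of _ "p(N := x)"]) auto
qed

section \<open>Integration as a bounded functional\<close>

text \<open>The properties of the Fourier kernels that matter for integration: every section has mean \<open>1\<close>
  and the diagonal is bounded by a constant \<open>B\<close>. They force the constant function \<open>1\<close> to belong to the
  space and to represent integration.\<close>

locale averaging_rkhs = rkhs X K H + prob_space M
  for X :: "'x set" and K :: "'x \<Rightarrow> 'x \<Rightarrow> complex" and H :: "'x fun_space" and M :: "'x measure" +
  fixes B :: real
  assumes space_M: "space M = X"
    and measurable_fns: "f \<in> fns H \<Longrightarrow> f \<in> borel_measurable M"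
    and diagonal_le: "x \<in> X \<Longrightarrow> Re (K x x) \<le> B"
    and section_mean: "y \<in> X \<Longrightarrow> (\<integral>x. kernel_section X K y x \<partial>M) = 1"
begin

text \<open>The representer of the equal-weight quadrature rule with nodes \<open>p\<close>.\<close>

definition mean_section :: "nat \<Rightarrow> (nat \<Rightarrow> 'x) \<Rightarrow> 'x \<Rightarrow> complex" where
  "mean_section N p = (\<lambda>x. (1 / of_nat N) * (\<Sum>n<N. kernel_section X K (p n) x))"

lemma mean_section_closed: "(\<And>n. n < N \<Longrightarrow> p n \<in> X) \<Longrightarrow> mean_section N p \<in> fns H"
  unfolding mean_section_def by (intro scale_closed sum_closed section_closed) auto

lemma ip_mean_section:
  assumes "f \<in> fns H" "\<And>n. n < N \<Longrightarrow> p n \<in> X"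
  shows "ip H f (mean_section N p) = (1 / of_nat N) * (\<Sum>n<N. f (p n))"
proof -
  have "ip H f (mean_section N p) = (1 / of_nat N) * (\<Sum>n<N. ip H f (kernel_section X K (p n)))"
  proof -
    have "(\<lambda>x. \<Sum>n<N. kernel_section X K (p n) x) \<in> fns H"
      by (rule sum_closed) (auto intro: section_closed assms)
    moreover have "ip H f (\<lambda>x. \<Sum>n<N. kernel_section X K (p n) x)
        = (\<Sum>n<N. ip H f (kernel_section X K (p n)))"
      by (rule ip_sum_right) (auto intro: section_closed assms)
    ultimately show ?thesis unfolding mean_section_def using assms(1) by (subst ip_scale_right) simp_all
  qed
  also have "\<dots> = (1 / of_nat N) * (\<Sum>n<N. f (p n))"
    using assms reproducing by simp
  finally show ?thesis .
qed

lemma hnorm_mean_section: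
  assumes "\<And>n. n < N \<Longrightarrow> p n \<in> X"
  shows "(hnorm H (mean_section N p))\<^sup>2 = (\<Sum>n<N. \<Sum>m<N. Re (K (p n) (p m))) / (real N)\<^sup>2"
proof -
  have "complex_of_real ((hnorm H (mean_section N p))\<^sup>2)
      = (1 / of_nat N) * (\<Sum>n<N. mean_section N p (p n))"
    using ip_mean_section ip_self mean_section_closed assms by metis
  also have "\<dots> = (\<Sum>n<N. \<Sum>m<N. K (p n) (p m)) / (of_nat N)\<^sup>2"
    using assms by (simp add: mean_section_def kernel_section_def sum_distrib_left[symmetric]
        power2_eq_square sum_divide_distrib[symmetric])
  also have "\<dots> = (\<Sum>n<N. \<Sum>m<N. K (p n) (p m)) / complex_of_real ((real N)\<^sup>2)" by simp
  finally have "Re (complex_of_real ((hnorm H (mean_section N p))\<^sup>2))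
      = Re ((\<Sum>n<N. \<Sum>m<N. K (p n) (p m)) / complex_of_real ((real N)\<^sup>2))" by metis
  then show ?thesis by (simp only: Re_divide_of_real Re_complex_of_real Re_sum)
qed

lemma kernel_hermitian: "x \<in> X \<Longrightarrow> y \<in> X \<Longrightarrow> K y x = cnj (K x y)"
  using reproducing[OF section_closed, of x y] reproducing[OF section_closed, of y x]
    ip_commute[OF section_closed section_closed, of x y] by (simp add: kernel_section_def)

lemma hnorm_section: "x \<in> X \<Longrightarrow> (hnorm H (kernel_section X K x))\<^sup>2 = Re (K x x)"
  using ip_self[OF section_closed, of x] reproducing[OF section_closed, of x x]
  by (simp add: kernel_section_def)

lemma norm_fn_le:
  assumes f: "f \<in> fns H" and x: "x \<in> X"
  shows "norm (f x) \<le> hnorm H f * sqrt B"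
proof -
  have "hnorm H (kernel_section X K x) \<le> sqrt B"
    using hnorm_section[OF x] diagonal_le[OF x] by (simp add: real_le_rsqrt)
  then have "hnorm H f * hnorm H (kernel_section X K x) \<le> hnorm H f * sqrt B"
    using hnorm_nonneg[OF f] by (rule mult_left_mono)
  then show ?thesis
    using Cauchy_Schwarz[OF f section_closed[OF x]] reproducing[OF f x] by simp
qed

lemma integrable_fn: "f \<in> fns H \<Longrightarrow> integrable M f"
  by (rule integrable_const_bound[where B = "hnorm H f * sqrt B"])
    (auto intro!: norm_fn_le measurable_fns simp: space_M)

text \<open>Greedy points for the kernel \<open>K - 1\<close>, to which the rank one kernel of the centred function
  \<open>f - \<integral>f\<close> is added: the same nodes then make the representer of the quadrature rule short and
  integrate \<open>f\<close> accurately.\<close>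

lemma exists_mean_section:
  assumes f: "f \<in> fns H" and N: "N \<ge> 1"
    and b: "\<And>x. x \<in> X \<Longrightarrow> (norm (f x - (\<integral>x. f x \<partial>M)))\<^sup>2 \<le> b"
  shows "\<exists>p. (\<forall>n. p n \<in> X) \<and> (hnorm H (mean_section N p))\<^sup>2 +
    (norm (ip H f (mean_section N p) - (\<integral>x. f x \<partial>M)))\<^sup>2 \<le> 1 + (B - 1 + b) / real N"
proof -
  define I where "I = (\<integral>x. f x \<partial>M)"
  define G where "G x y = Re (kernel_section X K y x) - 1 + Re ((f x - I) * cnj (f y - I))" for x y
  have "\<exists>p. (\<forall>n. p n \<in> space M) \<and> (\<Sum>n<N. \<Sum>m<N. G (p n) (p m)) \<le> real N * (B - 1 + b)"
  proof (rule greedy_points)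
    fix x y assume "x \<in> space M" "y \<in> space M"
    then show "G x y = G y x"
      using kernel_hermitian[of x y] by (simp add: G_def kernel_section_def space_M algebra_simps)
  next
    fix y assume y: "y \<in> space M"
    have 1: "integrable M (kernel_section X K y)" "integrable M f"
      using integrable_fn section_closed y space_M f by auto
    then show "integrable M (\<lambda>x. G x y)"
      unfolding G_def by (intro Bochner_Integration.integrable_add Bochner_Integration.integrable_diff
          integrable_Re integrable_mult_left integrable_const)
    have "(\<integral>x. G x y \<partial>M) = Re (\<integral>x. (kernel_section X K y x - 1) + (f x - I) * cnj (f y - I) \<partial>M)"
      unfolding G_def using 1 by (subst integral_Re[symmetric]) auto
    also have "(\<integral>x. (kernel_section X K y x - 1) + (f x - I) * cnj (f y - I) \<partial>M)
       = (\<integral>x. kernel_section X K y x \<partial>M) - 1 + ((\<integral>x. f x \<partial>M) - I) * cnj (f y - I)"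
      using 1 by (simp add: prob_space)
    finally show "(\<integral>x. G x y \<partial>M) = 0"
      using section_mean[of y] y by (simp add: space_M I_def)
  next
    fix x assume x: "x \<in> space M"
    then show "G x x \<le> B - 1 + b"
      using diagonal_le[of x] b[of x]
      by (simp add: G_def kernel_section_def space_M I_def[symmetric] cmod_power2)
        (simp add: power2_eq_square algebra_simps)
  qed
  then obtain p where p: "\<And>n. p n \<in> X" "(\<Sum>n<N. \<Sum>m<N. G (p n) (p m)) \<le> real N * (B - 1 + b)"
    by (auto simp: space_M)
  have "(\<Sum>n<N. \<Sum>m<N. G (p n) (p m)) = (\<Sum>n<N. \<Sum>m<N. Re (K (p n) (p m))) - (real N)\<^sup>2
      + Re ((\<Sum>n<N. f (p n) - I) * cnj (\<Sum>n<N. f (p n) - I))"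
  proof -
    have "Re ((\<Sum>n<N. f (p n) - I) * cnj (\<Sum>n<N. f (p n) - I))
        = (\<Sum>n<N. \<Sum>m<N. Re ((f (p n) - I) * cnj (f (p m) - I)))"
      by (simp only: cnj_sum sum_product Re_sum)
    then show ?thesis
      using p(1) by (simp only: G_def kernel_section_def sum.distrib sum_subtractf if_True)
        (simp add: power2_eq_square)
  qed
  also have "(\<Sum>n<N. f (p n) - I) = of_nat N * (ip H f (mean_section N p) - I)"
    using N p(1) by (simp add: ip_mean_section f sum_subtractf algebra_simps)
  also have "Re (of_nat N * (ip H f (mean_section N p) - I) * cnj (of_nat N * (ip H f (mean_section N p) - I)))
     = (real N)\<^sup>2 * (norm (ip H f (mean_section N p) - I))\<^sup>2"
    by (simp only: complex_norm_square[symmetric] Re_complex_of_real norm_mult norm_of_nat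
        power_mult_distrib)
  also have "(\<Sum>n<N. \<Sum>m<N. Re (K (p n) (p m))) = (real N)\<^sup>2 * (hnorm H (mean_section N p))\<^sup>2"
    using N p(1) by (simp add: hnorm_mean_section)
  finally have "(real N)\<^sup>2 * ((hnorm H (mean_section N p))\<^sup>2
      + (norm (ip H f (mean_section N p) - I))\<^sup>2 - 1) \<le> real N * (B - 1 + b)"
    using p(2) by (simp add: algebra_simps)
  then have "real N * (real N * ((hnorm H (mean_section N p))\<^sup>2
      + (norm (ip H f (mean_section N p) - I))\<^sup>2 - 1)) \<le> real N * (B - 1 + b)"
    by (simp add: power2_eq_square mult.assoc)
  then have "real N * ((hnorm H (mean_section N p))\<^sup>2
      + (norm (ip H f (mean_section N p) - I))\<^sup>2 - 1) \<le> B - 1 + b"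
    using N by (simp only: mult_le_cancel_left_pos of_nat_0_less_iff)
  then have "(hnorm H (mean_section N p))\<^sup>2
      + (norm (ip H f (mean_section N p) - I))\<^sup>2 - 1 \<le> (B - 1 + b) / real N"
    using N by (simp add: le_divide_eq mult.commute)
  then have "(hnorm H (mean_section N p))\<^sup>2
      + (norm (ip H f (mean_section N p) - I))\<^sup>2 \<le> 1 + (B - 1 + b) / real N"
    by simp
  then show ?thesis using p(1) unfolding I_def by blast
qed

lemma exists_short_mean_section:
  assumes "N \<ge> 1"
  shows "\<exists>p. (\<forall>n. p n \<in> X) \<and> (hnorm H (mean_section N p))\<^sup>2 \<le> 1 + (B - 1) / real N"
proof -
  obtain p where "\<forall>n. p n \<in> X" "(hnorm H (mean_section N p))\<^sup>2 +
    (norm (ip H (\<lambda>x. 0) (mean_section N p) - (\<integral>x. 0 \<partial>M)))\<^sup>2 \<le> 1 + (B - 1 + 0) / real N"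
    using exists_mean_section[OF zero_closed assms, of 0] by auto
  then show ?thesis by (intro exI[of _ p]) (simp add: ip_mean_section[OF zero_closed])
qed

text \<open>The integral of \<open>f\<close> is a limit of values \<open>\<langle>f, u\<rangle>\<close>, where \<open>u\<close> is a mean of sections with
  \<open>\<parallel>u\<parallel> \<le> 1 + \<delta>\<close>, and the Cauchy-Schwarz inequality applies. Lemma \<open>exists_mean_section\<close> controls only
  the sum of \<open>\<parallel>u\<parallel>\<^sup>2\<close> and the squared integration error, so \<open>f\<close> is first multiplied by a large constant \<open>T\<close>.
  That way the error is small even if \<open>\<parallel>u\<parallel>\<close> should be less than \<open>1\<close>.\<close>

lemma norm_integral_le_hnorm:
  assumes f: "f \<in> fns H"
  shows "norm (\<integral>x. f x \<partial>M) \<le> hnorm H f"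
proof (rule field_le_epsilon)
  fix e :: real assume e: "e > 0"
  define I where "I = (\<integral>x. f x \<partial>M)"
  \<comment> \<open>\<open>\<delta>\<close> and \<open>T\<close> are such that \<open>\<parallel>f\<parallel> \<delta> \<le> e / 2\<close>, and \<open>T * error \<le> 2\<close> means \<open>error \<le> e / 2\<close>\<close>
  define \<delta> where "\<delta> = e / (2 * (hnorm H f + 1))"
  have \<delta>: "\<delta> > 0" using e hnorm_nonneg[OF f] by (simp add: \<delta>_def)
  define T where "T = 4 / e"
  have T: "T > 0" using e by (simp add: T_def)
  define b where "b = (T * (hnorm H f * sqrt B + norm I))\<^sup>2"
  let ?g = "\<lambda>x. complex_of_real T * f x"
  define D where "D = max (B - 1 + b) 0"
  obtain N :: nat where N: "N \<ge> 1" "D / real N \<le> min 1 \<delta>"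
  proof -
    obtain n :: nat where n: "D / min 1 \<delta> < real n" using reals_Archimedean2 by blast
    have "D < real n * min 1 \<delta>" using n \<delta> by (simp add: divide_less_eq)
    also have "\<dots> \<le> real (Suc n) * min 1 \<delta>" using \<delta> by (intro mult_right_mono) auto
    finally have "D / real (Suc n) \<le> min 1 \<delta>" by (subst divide_le_eq) (simp add: mult.commute)
    then show ?thesis using that[of "Suc n"] by simp
  qed
  have b: "(norm (?g x - (\<integral>x. ?g x \<partial>M)))\<^sup>2 \<le> b" if "x \<in> X" for x
  proof -
    have "norm (?g x - (\<integral>x. ?g x \<partial>M)) = T * norm (f x - I)"
      using T by (simp add: I_def right_diff_distrib[symmetric] norm_mult)
    also have "\<dots> \<le> T * (hnorm H f * sqrt B + norm I)"
      using norm_fn_le[OF f that] norm_triangle_ineq4[of "f x" I] T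
      by (intro mult_left_mono) auto
    finally show ?thesis unfolding b_def by (rule power_mono) simp
  qed
  obtain p where p: "\<And>n. p n \<in> X"
    and le: "(hnorm H (mean_section N p))\<^sup>2 +
      (norm (ip H ?g (mean_section N p) - (\<integral>x. ?g x \<partial>M)))\<^sup>2 \<le> 1 + (B - 1 + b) / real N"
    using exists_mean_section[OF scale_closed[OF f] N(1) b] by auto
  let ?u = "mean_section N p"
  have u: "?u \<in> fns H" using p mean_section_closed by auto
  have "(B - 1 + b) / real N \<le> D / real N" by (intro divide_right_mono) (auto simp: D_def)
  then have le': "(hnorm H ?u)\<^sup>2 + (T * norm (ip H f ?u - I))\<^sup>2 \<le> 1 + min 1 \<delta>"
  proof -
    have "norm (ip H ?g ?u - (\<integral>x. ?g x \<partial>M)) = T * norm (ip H f ?u - I)"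
      using T by (simp add: ip_scale[OF f u] I_def right_diff_distrib[symmetric] norm_mult)
    with le have "(hnorm H ?u)\<^sup>2 + (T * norm (ip H f ?u - I))\<^sup>2 \<le> 1 + (B - 1 + b) / real N"
      by metis
    then show ?thesis using N(2) \<open>(B - 1 + b) / real N \<le> D / real N\<close> by linarith
  qed
  have "(hnorm H ?u)\<^sup>2 \<le> 1 + \<delta>"
    using le' zero_le_power2[of "T * norm (ip H f ?u - I)"] by linarith
  also have "\<dots> \<le> (1 + \<delta>)\<^sup>2" using \<delta> by (simp add: power2_sum)
  finally have 1: "hnorm H ?u \<le> 1 + \<delta>" by (rule power2_le_imp_le) (use \<delta> in linarith)
  have "(T * norm (ip H f ?u - I))\<^sup>2 \<le> 2\<^sup>2" using le' zero_le_power2[of "hnorm H ?u"] unfolding power2_eq_square[of 2] by linarith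
  then have "T * norm (ip H f ?u - I) \<le> 2" by (rule power2_le_imp_le) simp
  then have 2: "norm (ip H f ?u - I) \<le> e / 2" using e by (simp add: T_def field_simps)
  have "norm I \<le> norm (ip H f ?u) + norm (ip H f ?u - I)"
    by (metis norm_minus_commute norm_triangle_sub)
  also have "\<dots> \<le> hnorm H f * (1 + \<delta>) + e / 2"
    using Cauchy_Schwarz[OF f u] mult_left_mono[OF 1 hnorm_nonneg[OF f]] 2 by linarith
  also have "hnorm H f * \<delta> \<le> e / 2"
    using e hnorm_nonneg[OF f] by (simp add: \<delta>_def field_simps)
  then have "hnorm H f * (1 + \<delta>) + e / 2 \<le> hnorm H f + e" by (simp add: algebra_simps)
  finally show "norm (\<integral>x. f x \<partial>M) \<le> hnorm H f + e" by (simp add: I_def)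
qed

definition one_fn :: "'x \<Rightarrow> complex" where
  "one_fn = (\<lambda>x. if x \<in> X then 1 else 0)"

lemma integral_mean_section:
  assumes "N \<ge> 1" "\<And>n. n < N \<Longrightarrow> p n \<in> X"
  shows "(\<integral>x. mean_section N p x \<partial>M) = 1"
  unfolding mean_section_def using assms integrable_fn[OF section_closed] section_mean
  by (simp add: Bochner_Integration.integral_sum)

text \<open>Short means of sections have norms tending to \<open>1\<close>, the least possible norm of a function with
  integral \<open>1\<close>. By the parallelogram law such a minimising sequence converges.\<close>

lemma ex_minimal_fn:
  "\<exists>h\<in>fns H. hnorm H h \<le> 1 \<and> (\<integral>x. h x \<partial>M) = 1"
proof -
  have "\<exists>u\<in>fns H. (hnorm H u)\<^sup>2 \<le> 1 + \<bar>B - 1\<bar> / real (Suc n) \<and> (\<integral>x. u x \<partial>M) = 1" for n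
  proof -
    obtain p where p: "\<And>n. p n \<in> X"
      "(hnorm H (mean_section (Suc n) p))\<^sup>2 \<le> 1 + (B - 1) / real (Suc n)"
      using exists_short_mean_section[of "Suc n"] by auto
    have "(B - 1) / real (Suc n) \<le> \<bar>B - 1\<bar> / real (Suc n)" by (intro divide_right_mono) auto
    with p show ?thesis
      by (intro bexI[of _ "mean_section (Suc n) p"] conjI integral_mean_section)
        (auto intro: mean_section_closed)
  qed
  then obtain u where u: "\<And>n. u n \<in> fns H" "\<And>n. (hnorm H (u n))\<^sup>2 \<le> 1 + \<bar>B - 1\<bar> / real (Suc n)"
    "\<And>n. (\<integral>x. u n x \<partial>M) = 1"
    by metis
  have cauchy: "(hnorm H (\<lambda>x. u n x - u m x))\<^sup>2
      \<le> 2 * \<bar>B - 1\<bar> / real (Suc n) + 2 * \<bar>B - 1\<bar> / real (Suc m)" for n m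
  proof -
    have "(\<integral>x. u n x + u m x \<partial>M) = 2" using u integrable_fn by simp
    then have "2 \<le> hnorm H (\<lambda>x. u n x + u m x)"
      using norm_integral_le_hnorm[OF add_closed[OF u(1)[of n] u(1)[of m]]] by simp
    then have "2\<^sup>2 \<le> (hnorm H (\<lambda>x. u n x + u m x))\<^sup>2" by (rule power_mono) simp
    \<comment> \<open>\<open>\<parallel>u - v\<parallel>\<^sup>2 = 2 \<parallel>u\<parallel>\<^sup>2 + 2 \<parallel>v\<parallel>\<^sup>2 - \<parallel>u + v\<parallel>\<^sup>2\<close>, and the last term is at least \<open>4\<close>\<close>
    then show ?thesis
      using hnorm_add_sq[OF u(1)[of n] u(1)[of m]] hnorm_diff_sq[OF u(1)[of n] u(1)[of m]]
        u(2)[of n] u(2)[of m] by simp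
  qed
  have lim0: "(\<lambda>n. \<bar>B - 1\<bar> / real (Suc n)) \<longlonglongrightarrow> 0"
    using LIMSEQ_Suc[OF lim_const_over_n] by simp
  have "\<exists>h\<in>fns H. (\<lambda>n. hnorm H (\<lambda>x. u n x - h x)) \<longlonglongrightarrow> 0"
  proof (rule complete)
    fix e :: real assume e: "e > 0"
    then have "eventually (\<lambda>n. \<bar>B - 1\<bar> / real (Suc n) < e\<^sup>2 / 4) sequentially"
      by (intro order_tendstoD(2)[OF lim0]) simp
    then obtain M0 where M0: "\<And>n. n \<ge> M0 \<Longrightarrow> \<bar>B - 1\<bar> / real (Suc n) < e\<^sup>2 / 4"
      by (auto simp: eventually_sequentially)
    have "hnorm H (\<lambda>x. u m x - u n x) < e" if "m \<ge> M0" "n \<ge> M0" for m n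
    proof (rule power2_less_imp_less)
      show "(hnorm H (\<lambda>x. u m x - u n x))\<^sup>2 < e\<^sup>2"
        using cauchy[of m n] M0[OF that(1)] M0[OF that(2)] by linarith
    qed (use e in simp)
    then show "\<exists>M0. \<forall>m\<ge>M0. \<forall>n\<ge>M0. hnorm H (\<lambda>x. u m x - u n x) < e" by blast
  qed (rule u)
  then obtain h where h: "h \<in> fns H" "(\<lambda>n. hnorm H (\<lambda>x. u n x - h x)) \<longlonglongrightarrow> 0" by blast
  have "norm (1 - (\<integral>x. h x \<partial>M)) \<le> 0"
  proof (rule LIMSEQ_le_const[OF h(2)])
    have "norm (1 - (\<integral>x. h x \<partial>M)) \<le> hnorm H (\<lambda>x. u n x - h x)" for n
      using norm_integral_le_hnorm[OF diff_closed[OF u(1)[of n] h(1)]] u(3)[of n]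
        integrable_fn[OF u(1)[of n]] integrable_fn[OF h(1)] by simp
    then show "\<exists>N. \<forall>n\<ge>N. norm (1 - (\<integral>x. h x \<partial>M)) \<le> hnorm H (\<lambda>x. u n x - h x)" by blast
  qed
  then have 1: "(\<integral>x. h x \<partial>M) = 1" by simp
  have "hnorm H h \<le> sqrt (1 + 0) + 0"
  proof (rule LIMSEQ_le_const)
    show "(\<lambda>n. sqrt (1 + \<bar>B - 1\<bar> / real (Suc n)) + hnorm H (\<lambda>x. u n x - h x)) \<longlonglongrightarrow> sqrt (1 + 0) + 0"
      by (intro tendsto_intros lim0 h)
    have "hnorm H h \<le> sqrt (1 + \<bar>B - 1\<bar> / real (Suc n)) + hnorm H (\<lambda>x. u n x - h x)" for n
    proof -
      have "hnorm H (\<lambda>x. h x - u n x) = hnorm H (\<lambda>x. u n x - h x)"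
        using hnorm_scale[OF diff_closed[OF u(1)[of n] h(1)], of "-1"] by simp
      moreover have "hnorm H h \<le> hnorm H (u n) + hnorm H (\<lambda>x. h x - u n x)"
        using hnorm_triangle[OF u(1)[of n] diff_closed[OF h(1) u(1)[of n]]] by simp
      moreover have "hnorm H (u n) \<le> sqrt (1 + \<bar>B - 1\<bar> / real (Suc n))"
        by (rule real_le_rsqrt) (rule u(2))
      ultimately show ?thesis by linarith
    qed
    then show "\<exists>N. \<forall>n\<ge>N. hnorm H h
        \<le> sqrt (1 + \<bar>B - 1\<bar> / real (Suc n)) + hnorm H (\<lambda>x. u n x - h x)" by blast
  qed
  with h 1 show ?thesis by auto
qed

text \<open>The minimal function \<open>h\<close> is orthogonal to every function with integral zero, hence it represents
  integration. Its value at \<open>y\<close> is therefore the conjugate mean of the section at \<open>y\<close>, which is \<open>1\<close>.\<close>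

lemma one_closed: "one_fn \<in> fns H"
  and ip_one: "f \<in> fns H \<Longrightarrow> ip H f one_fn = (\<integral>x. f x \<partial>M)"
proof -
  obtain h where h: "h \<in> fns H" "hnorm H h \<le> 1" "(\<integral>x. h x \<partial>M) = 1"
    using ex_minimal_fn by blast
  have h1: "hnorm H h = 1" using norm_integral_le_hnorm[OF h(1)] h by simp
  have rep: "ip H f h = (\<integral>x. f x \<partial>M)" if f: "f \<in> fns H" for f
  proof -
    define I where "I = (\<integral>x. f x \<partial>M)"
    define g where "g = (\<lambda>x. f x - I * h x)"
    have g: "g \<in> fns H" unfolding g_def by (intro diff_closed scale_closed f h)
    have g0: "(\<integral>x. g x \<partial>M) = 0"
      using integrable_fn f h by (simp add: g_def I_def)
    have "ip H h g = 0"
    proof (rule orthogonal_if_norm_minimal[OF h(1) g])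
      fix t
      show "hnorm H h \<le> hnorm H (\<lambda>x. h x + t * g x)"
        using norm_integral_le_hnorm[OF add_closed[OF h(1) scale_closed[OF g, of t]]]
          integrable_fn[OF h(1)] integrable_fn[OF g] g0 h(3) h1 by simp
    qed
    then have "ip H g h = 0" using ip_commute[OF h(1) g] by simp
    then show ?thesis
      using h1 by (simp add: g_def ip_diff ip_scale f h scale_closed ip_self I_def)
  qed
  have "h = one_fn"
  proof
    fix y
    show "h y = one_fn y"
    proof (cases "y \<in> X")
      case True
      then have "h y = cnj (ip H (kernel_section X K y) h)"
        using reproducing[OF h(1) True] ip_commute[OF section_closed[OF True] h(1)] by simp
      then show ?thesis
        using rep[OF section_closed[OF True]] section_mean[OF True] True by (simp add: one_fn_def)
    qed (use support h in \<open>auto simp: one_fn_def\<close>)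
  qed
  then show "one_fn \<in> fns H" "f \<in> fns H \<Longrightarrow> ip H f one_fn = (\<integral>x. f x \<partial>M)"
    using h rep by auto
qed

lemma hnorm_one: "hnorm H one_fn = 1"
proof -
  have "(\<integral>x. one_fn x \<partial>M) = (\<integral>x. 1 \<partial>M)"
    by (rule Bochner_Integration.integral_cong) (auto simp: one_fn_def space_M)
  then have "complex_of_real ((hnorm H one_fn)\<^sup>2) = 1"
    using ip_self[OF one_closed] ip_one[OF one_closed] by (simp add: prob_space)
  then have "(hnorm H one_fn)\<^sup>2 = 1" by (simp only: of_real_eq_1_iff)
  then show ?thesis using hnorm_nonneg[OF one_closed] by (simp add: power2_eq_1_iff)
qed

lemma SUP_integral:
  "(SUP f\<in>{f \<in> fns H. hnorm H f \<le> 1}. ennreal (norm (\<integral>x. f x \<partial>M))) = 1"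
proof -
  have "(SUP f\<in>{f \<in> fns H. hnorm H f \<le> 1}. ennreal (norm (\<integral>x. f x \<partial>M)))
     = (SUP f\<in>{f \<in> fns H. hnorm H f \<le> 1}. ennreal (norm (ip H f one_fn)))"
    by (intro SUP_cong) (auto simp: ip_one)
  then show ?thesis using SUP_unit_ball_ip[OF one_closed] hnorm_one by simp
qed

text \<open>The error functional is represented by \<open>1 - u\<close> with \<open>u\<close> the mean of the sections at the nodes,
  and \<open>\<parallel>1 - u\<parallel>\<^sup>2 = 1 - 2 + \<parallel>u\<parallel>\<^sup>2\<close>.\<close>

lemma SUP_integration_error:
  assumes N: "N \<ge> 1" and p: "\<And>n. n < N \<Longrightarrow> p n \<in> X"
  shows "(SUP f\<in>{f \<in> fns H. hnorm H f \<le> 1}.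
      ennreal (norm ((\<integral>x. f x \<partial>M) - (1 / of_nat N) * (\<Sum>n<N. f (p n)))))
    = ennreal (sqrt ((\<Sum>n<N. \<Sum>m<N. Re (K (p n) (p m))) / (real N)\<^sup>2 - 1))"
proof -
  let ?u = "mean_section N p"
  have u: "?u \<in> fns H" using p by (rule mean_section_closed)
  define d where "d = (\<lambda>x. one_fn x - ?u x)"
  have d: "d \<in> fns H" unfolding d_def by (intro diff_closed one_closed u)
  have "(SUP f\<in>{f \<in> fns H. hnorm H f \<le> 1}.
      ennreal (norm ((\<integral>x. f x \<partial>M) - (1 / of_nat N) * (\<Sum>n<N. f (p n)))))
     = (SUP f\<in>{f \<in> fns H. hnorm H f \<le> 1}. ennreal (norm (ip H f d)))"
    by (intro SUP_cong) (auto simp: ip_one d_def ip_diff_right one_closed u ip_mean_section p)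
  also have "\<dots> = ennreal (hnorm H d)" by (rule SUP_unit_ball_ip[OF d])
  also have "hnorm H d = sqrt ((\<Sum>n<N. \<Sum>m<N. Re (K (p n) (p m))) / (real N)\<^sup>2 - 1)"
  proof (rule real_sqrt_unique[symmetric])
    have "ip H one_fn ?u = 1" using ip_commute[OF u one_closed] ip_one[OF u]
      integral_mean_section[OF N p] by simp
    then have "(hnorm H d)\<^sup>2 = (hnorm H ?u)\<^sup>2 - 1"
      using hnorm_diff_sq[OF one_closed u] hnorm_one by (simp add: d_def)
    then show "(hnorm H d)\<^sup>2 = (\<Sum>n<N. \<Sum>m<N. Re (K (p n) (p m))) / (real N)\<^sup>2 - 1"
      using hnorm_mean_section[of N p, OF p] by simp
  qed (rule hnorm_nonneg[OF d])
  finally show ?thesis .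
qed

lemma ex_small_error:
  assumes N: "N \<ge> 1"
  shows "\<exists>p. (\<forall>n. p n \<in> X) \<and> (\<Sum>n<N. \<Sum>m<N. Re (K (p n) (p m))) / (real N)\<^sup>2 - 1 \<le> (B - 1) / real N"
proof -
  obtain p where p: "\<And>n. p n \<in> X" "(hnorm H (mean_section N p))\<^sup>2 \<le> 1 + (B - 1) / real N"
    using exists_short_mean_section[OF N] by auto
  then show ?thesis using hnorm_mean_section[of N p] by (intro exI[of _ p]) auto
qed

end

section \<open>Fourier kernels\<close>

abbreviation unit_interval :: "real measure" where
  "unit_interval \<equiv> restrict_space lborel {0..1}"

lemma prob_space_unit_interval: "prob_space unit_interval"
  by (rule prob_space_restrict_space) simp_all

lemma prob_space_cube_measure: "prob_space (cube_measure s)"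
  unfolding cube_measure_def by (intro prob_space_PiM prob_space_unit_interval)

lemma space_cube_measure: "space (cube_measure s) = unit_cube s"
  by (simp add: cube_measure_def unit_cube_def space_PiM space_restrict_space)

definition fourier_series :: "(int \<Rightarrow> real) \<Rightarrow> real \<Rightarrow> complex" where
  "fourier_series a t = (\<Sum>\<^sub>\<infinity>k. complex_of_real (a k) * cis (2 * pi * (real_of_int k * t)))"

definition phase :: "nat \<Rightarrow> (nat \<Rightarrow> int) \<Rightarrow> (nat \<Rightarrow> real) \<Rightarrow> complex" where
  "phase s k x = cis (2 * pi * (\<Sum>j<s. real_of_int (k j) * x j))"

lemma uniform_limit_fourier_series:
  assumes "\<And>k. 0 \<le> a k" "a summable_on UNIV"
  shows "uniform_limit UNIV
    (\<lambda>F t. \<Sum>k\<in>F. complex_of_real (a k) * cis (2 * pi * (real_of_int k * t)))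
    (fourier_series a) (finite_subsets_at_top UNIV)"
  unfolding fourier_series_def
  by (rule Weierstrass_m_test_general) (use assms in \<open>auto simp: norm_mult\<close>)

lemma continuous_fourier_series:
  assumes "\<And>k. 0 \<le> a k" "a summable_on UNIV"
  shows "continuous_on UNIV (fourier_series a)"
  by (rule uniform_limit_theorem[OF _ uniform_limit_fourier_series[OF assms]])
    (auto intro!: always_eventually continuous_intros)

lemma integral_cis_unit_interval:
  "(\<integral>x. cis (2 * pi * (real_of_int k * (x - y))) \<partial>unit_interval) = (if k = 0 then 1 else 0)"
proof (cases "k = 0")
  case True
  then show ?thesis
    using prob_space.prob_space[OF prob_space_unit_interval] by simp
next
  case False
  define c where "c = 2 * pi * real_of_int k"
  have c: "c \<noteq> 0" using False by (simp add: c_def)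
  have eq: "2 * pi * (real_of_int k * (x - y)) = c * x - c * y" for x
    by (simp add: c_def algebra_simps)
  have rot: "- (\<i> * (E * \<i>)) = E" for E by (simp add: complex_eq_iff)
  define F where "F x = cis (c * x - c * y) / (\<i> * of_real c)" for x
  have "(\<integral>x. cis (c * x - c * y) \<partial>unit_interval)
      = (\<integral>x. indicator {0..1} x *\<^sub>R cis (c * x - c * y) \<partial>lborel)"
    by (rule integral_restrict_space) simp
  also have "\<dots> = F 1 - F 0"
  proof (rule integral_FTC_atLeastAtMost)
    fix x
    have "((\<lambda>z. exp (\<i> * (of_real c * z - of_real (c * y))) / (\<i> * of_real c))
        has_field_derivative exp (\<i> * (of_real c * of_real x - of_real (c * y))))
        (at (of_real x))"
      using c by (auto intro!: derivative_eq_intros) (simp only: rot)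
    from has_vector_derivative_real_field[OF this]
    show "(F has_vector_derivative cis (c * x - c * y)) (at x within {0..1})"
      by (simp add: F_def[abs_def] cis_conv_exp)
  qed (auto intro!: continuous_intros)
  also have "F 1 = F 0"
  proof -
    have "cis (c * 1 - c * y) = cis (c * 0 - c * y) * cis c"
      by (simp add: cis_mult add.commute)
    also have "cis c = 1" unfolding c_def using cis_multiple_2pi[of "real_of_int k"] by simp
    finally show ?thesis by (simp add: F_def)
  qed
  finally show ?thesis using False by (simp add: eq)
qed

lemma integrable_unit_interval:
  fixes f :: "real \<Rightarrow> complex"
  assumes "continuous_on UNIV f"
  shows "integrable unit_interval f"
  using borel_integrable_compact[of "{0..1}" f] continuous_on_subset[OF assms, of "{0..1}"]
  by (simp add: integrable_restrict_space)

text \<open>Only the constant term survives, by uniform convergence of the finite partial sums.\<close>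

lemma integral_fourier_series:
  assumes a: "\<And>k. 0 \<le> a k" "a summable_on UNIV"
  shows "(\<integral>x. fourier_series a (x - y) \<partial>unit_interval) = complex_of_real (a 0)"
proof -
  interpret prob_space unit_interval by (rule prob_space_unit_interval)
  have int: "integrable unit_interval (\<lambda>x. fourier_series a (x - y))"
    by (intro integrable_unit_interval continuous_on_compose2[OF continuous_fourier_series[OF a]]
        continuous_intros) auto
  have "norm ((\<integral>x. fourier_series a (x - y) \<partial>unit_interval) - a 0) \<le> 0 + e" if e: "e > 0" for e
  proof -
    let ?S = "\<lambda>F t. \<Sum>k\<in>F. complex_of_real (a k) * cis (2 * pi * (real_of_int k * t))"
    have "\<forall>\<^sub>F F in finite_subsets_at_top UNIV. \<forall>t\<in>UNIV. dist (?S F t) (fourier_series a t) < e"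
      using uniform_limit_fourier_series[OF a] e by (rule uniform_limitD)
    moreover have "\<forall>\<^sub>F F in finite_subsets_at_top UNIV. finite F \<and> (0::int) \<in> F"
      by (auto simp: eventually_finite_subsets_at_top intro!: exI[of _ "{0}"])
    ultimately have "\<forall>\<^sub>F F in finite_subsets_at_top UNIV.
        (\<forall>t\<in>UNIV. dist (?S F t) (fourier_series a t) < e) \<and> finite F \<and> (0::int) \<in> F"
      by (rule eventually_conj)
    from eventually_happens'[OF finite_subsets_at_top_neq_bot this]
    obtain F where F: "\<And>t. dist (?S F t) (fourier_series a t) < e" "finite F" "0 \<in> F"
      by auto
    have intS: "integrable unit_interval (\<lambda>x. ?S F (x - y))"
      by (intro integrable_unit_interval continuous_intros)
    have "(\<integral>x. ?S F (x - y) \<partial>unit_interval)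
        = (\<Sum>k\<in>F. complex_of_real (a k) * (\<integral>x. cis (2 * pi * (real_of_int k * (x - y))) \<partial>unit_interval))"
      by (subst Bochner_Integration.integral_sum)
        (auto intro!: integrable_unit_interval continuous_intros)
    also have "\<dots> = complex_of_real (a 0)"
      using F(2,3) by (simp add: integral_cis_unit_interval sum.delta' if_distrib cong: if_cong)
    finally have "(\<integral>x. fourier_series a (x - y) \<partial>unit_interval) - a 0
        = (\<integral>x. fourier_series a (x - y) - ?S F (x - y) \<partial>unit_interval)"
      using int intS by simp
    also have "norm \<dots> \<le> (\<integral>x. e \<partial>unit_interval)"
      using F(1) int intS
      by (intro Bochner_Integration.integral_norm_bound_integral) (auto simp: dist_norm norm_minus_commute less_imp_le)
    also have "(\<integral>x. e \<partial>unit_interval) = e"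
      by (simp only: lebesgue_integral_const prob_space) simp
    finally show ?thesis by simp
  qed
  then have "norm ((\<integral>x. fourier_series a (x - y) \<partial>unit_interval) - a 0) \<le> 0"
    by (rule field_le_epsilon)
  then show ?thesis by simp
qed

locale fourier_weights =
  fixes w :: "nat \<Rightarrow> int \<Rightarrow> real"
  assumes weight_nonneg: "0 \<le> w j k"
    and weight_zero: "w j 0 = 1"
    and weight_summable: "w j summable_on UNIV"
begin

lemma fourier_term:
  "complex_of_real (\<Prod>j<s. w j (k j)) *
      exp (2 * pi * \<i> * complex_of_real (\<Sum>j<s. real_of_int (k j) * (x j - y j)))
   = (\<Prod>j<s. complex_of_real (w j (k j)) * cis (2 * pi * (real_of_int (k j) * (x j - y j))))"
  "complex_of_real (\<Prod>j<s. w j (k j)) *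
      exp (2 * pi * \<i> * complex_of_real (\<Sum>j<s. real_of_int (k j) * (x j - y j)))
   = complex_of_real (\<Prod>j<s. w j (k j)) * (phase s k x * cnj (phase s k y))"
proof -
  have 1: "exp (2 * pi * \<i> * complex_of_real r) = cis (2 * pi * r)" for r
    by (simp add: cis_conv_exp mult_ac)
  have "cis (2 * pi * (\<Sum>j<s. real_of_int (k j) * (x j - y j)))
      = (\<Prod>j<s. cis (2 * pi * (real_of_int (k j) * (x j - y j))))"
    by (induction s) (simp_all add: cis_mult[symmetric] distrib_left)
  then show "complex_of_real (\<Prod>j<s. w j (k j)) *
      exp (2 * pi * \<i> * complex_of_real (\<Sum>j<s. real_of_int (k j) * (x j - y j)))
   = (\<Prod>j<s. complex_of_real (w j (k j)) * cis (2 * pi * (real_of_int (k j) * (x j - y j))))"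
    by (simp only: 1 prod.distrib of_real_prod)
  have "2 * pi * (\<Sum>j<s. real_of_int (k j) * (x j - y j))
     = 2 * pi * (\<Sum>j<s. real_of_int (k j) * x j) + - (2 * pi * (\<Sum>j<s. real_of_int (k j) * y j))"
    by (simp add: right_diff_distrib sum_subtractf)
  then have "cis (2 * pi * (\<Sum>j<s. real_of_int (k j) * (x j - y j))) = phase s k x * cnj (phase s k y)"
    by (simp only: phase_def cis_cnj cis_mult)
  then show "complex_of_real (\<Prod>j<s. w j (k j)) *
      exp (2 * pi * \<i> * complex_of_real (\<Sum>j<s. real_of_int (k j) * (x j - y j)))
   = complex_of_real (\<Prod>j<s. w j (k j)) * (phase s k x * cnj (phase s k y))"
    by (simp only: 1)
qed

lemma norm_phase [simp]: "norm (phase s k x) = 1"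
  by (simp add: phase_def)

lemma fourier_kernel_eq_prod: "fourier_kernel w s x y = (\<Prod>j<s. fourier_series (w j) (x j - y j))"
  unfolding fourier_kernel_def fourier_term(1) int_vectors_def fourier_series_def
  by (rule infsum_prod_PiE_abs)
    (auto simp: norm_mult weight_nonneg weight_summable)

lemma prod_weight_summable: "(\<lambda>k. \<Prod>j<s. w j (k j)) summable_on int_vectors s"
proof -
  have "Infinite_Set_Sum.abs_summable_on (\<lambda>k. \<Prod>j<s. w j (k j)) (int_vectors s)"
    unfolding int_vectors_def
  proof (rule abs_summable_on_prod_PiE)
    fix j
    show "Infinite_Set_Sum.abs_summable_on (w j) UNIV"
      unfolding abs_summable_equivalent[symmetric] by (simp add: weight_nonneg weight_summable)
  qed auto
  then show ?thesis
    unfolding abs_summable_equivalent[symmetric] by (rule abs_summable_summable)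
qed

lemma has_sum_fourier_kernel:
  "((\<lambda>k. complex_of_real (\<Prod>j<s. w j (k j)) * (phase s k x * cnj (phase s k y)))
    has_sum fourier_kernel w s x y) (int_vectors s)"
  unfolding fourier_kernel_def fourier_term(2)
proof (rule has_sum_infsum, rule abs_summable_summable)
  have "norm (complex_of_real (\<Prod>j<s. w j (k j)) * (phase s k x * cnj (phase s k y)))
      = (\<Prod>j<s. w j (k j))" for k
    by (simp add: norm_mult prod_nonneg weight_nonneg del: of_real_prod)
  then show "(\<lambda>k. norm (complex_of_real (\<Prod>j<s. w j (k j)) * (phase s k x * cnj (phase s k y))))
      summable_on int_vectors s"
    using prod_weight_summable by simp
qed

text \<open>In this form the squared worst-case error is visibly monotone in the weights.\<close>

lemma has_sum_sum_fourier_kernel: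
  fixes N :: nat
  shows "((\<lambda>k. (\<Prod>j<s. w j (k j)) * (norm (\<Sum>n<N. phase s k (p n)))\<^sup>2)
    has_sum (\<Sum>n<N. \<Sum>m<N. Re (fourier_kernel w s (p n) (p m)))) (int_vectors s)"
proof -
  have sums: "((\<lambda>k. \<Sum>n\<in>A. \<Sum>m\<in>C. complex_of_real (\<Prod>j<s. w j (k j)) * (phase s k (p n) * cnj (phase s k (p m))))
    has_sum (\<Sum>n\<in>A. \<Sum>m\<in>C. fourier_kernel w s (p n) (p m))) (int_vectors s)"
    if "finite A" "finite C" for A C :: "nat set"
  proof -
    have *: "((\<lambda>k. \<Sum>m\<in>C. complex_of_real (\<Prod>j<s. w j (k j)) * (phase s k (p n) * cnj (phase s k (p m))))
    has_sum (\<Sum>m\<in>C. fourier_kernel w s (p n) (p m))) (int_vectors s)" for n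
      using \<open>finite C\<close> by induction (auto intro!: has_sum_add has_sum_fourier_kernel simp del: of_real_prod)
    show ?thesis using \<open>finite A\<close> by induction (auto intro!: has_sum_add * simp del: of_real_prod)
  qed
  from has_sum_Re[OF sums[OF finite_lessThan finite_lessThan]]
  have "((\<lambda>k. Re (\<Sum>n<N. \<Sum>m<N. complex_of_real (\<Prod>j<s. w j (k j)) * (phase s k (p n) * cnj (phase s k (p m)))))
    has_sum Re (\<Sum>n<N. \<Sum>m<N. fourier_kernel w s (p n) (p m))) (int_vectors s)" .
  moreover have "Re (\<Sum>n<N. \<Sum>m<N. complex_of_real W * (phase s k (p n) * cnj (phase s k (p m))))
      = W * (norm (\<Sum>n<N. phase s k (p n)))\<^sup>2" for W k
  proof -
    have "(\<Sum>n<N. \<Sum>m<N. complex_of_real W * (phase s k (p n) * cnj (phase s k (p m))))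
      = complex_of_real W * ((\<Sum>n<N. phase s k (p n)) * cnj (\<Sum>n<N. phase s k (p n)))"
      by (simp only: sum_distrib_left[symmetric] cnj_sum sum_product)
    also have "\<dots> = complex_of_real (W * (norm (\<Sum>n<N. phase s k (p n)))\<^sup>2)"
      by (simp only: complex_norm_square[symmetric] of_real_mult)
    finally show ?thesis by (metis Re_complex_of_real)
  qed
  ultimately show ?thesis by (simp only: Re_sum[symmetric])
qed

lemma fourier_kernel_diagonal: "fourier_kernel w s x x = complex_of_real (\<Prod>j<s. \<Sum>\<^sub>\<infinity>k. w j k)"
proof -
  have "fourier_series (w j) 0 = complex_of_real (\<Sum>\<^sub>\<infinity>k. w j k)" for j
    unfolding fourier_series_def
    using has_sum_of_real[OF has_sum_infsum[OF weight_summable[of j]], where ?'a = complex]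
    by (simp add: infsumI)
  then show ?thesis by (simp add: fourier_kernel_eq_prod)
qed

lemma Re_fourier_kernel_diagonal: "Re (fourier_kernel w s x x) = (\<Prod>j<s. \<Sum>\<^sub>\<infinity>k. w j k)"
  by (simp only: fourier_kernel_diagonal Re_complex_of_real)

lemma integral_fourier_kernel: "(\<integral>x. fourier_kernel w s x y \<partial>cube_measure s) = 1"
proof -
  interpret product_sigma_finite "\<lambda>_::nat. unit_interval"
    using prob_space_imp_sigma_finite[OF prob_space_unit_interval]
    by (intro product_sigma_finite.intro)
  have "(\<integral>x. fourier_kernel w s x y \<partial>cube_measure s)
      = (\<Prod>j<s. \<integral>t. fourier_series (w j) (t - y j) \<partial>unit_interval)"
    unfolding fourier_kernel_eq_prod cube_measure_def
    by (rule product_integral_prod)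
      (auto intro!: integrable_unit_interval continuous_intros
        continuous_on_compose2[OF continuous_fourier_series[OF weight_nonneg weight_summable]])
  then show ?thesis
    by (simp add: integral_fourier_series weight_nonneg weight_summable weight_zero)
qed

end

lemma sum_fourier_kernel_mono:
  fixes N :: nat
  assumes "fourier_weights w" "fourier_weights w'" "\<And>j k. w' j k \<le> w j k"
  shows "(\<Sum>n<N. \<Sum>m<N. Re (fourier_kernel w' s (p n) (p m)))
       \<le> (\<Sum>n<N. \<Sum>m<N. Re (fourier_kernel w s (p n) (p m)))"
  by (rule has_sum_mono[OF fourier_weights.has_sum_sum_fourier_kernel[OF assms(2)]
        fourier_weights.has_sum_sum_fourier_kernel[OF assms(1)]])
    (auto intro!: mult_right_mono prod_mono simp: assms(3) fourier_weights.weight_nonneg[OF assms(2)] fourier_weights.weight_nonneg[OF assms(1)])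

text \<open>Weights cut down to the frequencies \<open>-1\<close>, \<open>0\<close>, \<open>1\<close> give the factor \<open>1 + 2 c cos (2 \<pi> t)\<close>, a
  nonnegative kernel as soon as \<open>c \<le> 1 / 2\<close>.\<close>

definition cosine_weight :: "real \<Rightarrow> int \<Rightarrow> real" where
  "cosine_weight c k = (if k = 0 then 1 else if \<bar>k\<bar> = 1 then c else 0)"

lemma has_sum_cosine_weight:
  fixes g :: "int \<Rightarrow> 'a::{real_normed_algebra_1}"
  shows "((\<lambda>k. of_real (cosine_weight c k) * g k) has_sum (g 0 + of_real c * (g 1 + g (- 1)))) UNIV"
  by (rule has_sum_finite_neutralI[of "{-1,0,1}"])
    (auto simp: cosine_weight_def algebra_simps)

lemma fourier_weights_cosine:
  assumes "\<And>j. 0 \<le> c j"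
  shows "fourier_weights (\<lambda>j. cosine_weight (c j))"
proof
  show "cosine_weight (c j) summable_on UNIV" for j
    using has_sum_cosine_weight[of "c j" "\<lambda>_. 1::real"] by (auto simp: summable_on_def)
qed (use assms in \<open>auto simp: cosine_weight_def\<close>)

lemma fourier_series_cosine:
  "fourier_series (cosine_weight c) t = complex_of_real (1 + 2 * c * cos (2 * pi * t))"
proof -
  have "fourier_series (cosine_weight c) t
      = 1 + complex_of_real c * (cis (2 * pi * t) + cis (- (2 * pi * t)))"
    unfolding fourier_series_def
    by (rule infsumI) (use has_sum_cosine_weight[of c "\<lambda>k. cis (2 * pi * (real_of_int k * t))"] in simp)
  then show ?thesis by (simp add: complex_eq_iff)
qed

text \<open>The lower bound for arbitrary point sets. The kernel is compared with a product of factors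
  \<open>1 + 2 c cos (2 \<pi> t)\<close>, which is nonnegative everywhere, so that the off-diagonal terms can be
  dropped.\<close>

lemma sum_kernel_ge_diagonal:
  assumes w: "fourier_weights w"
    and c: "\<And>j. 0 \<le> c j" "\<And>j. c j \<le> 1 / 2" "\<And>j. c j \<le> w j 1" "\<And>j. c j \<le> w j (- 1)"
  shows "real N * (\<Prod>j<s. 1 + 2 * c j) \<le> (\<Sum>n<N. \<Sum>m<N. Re (fourier_kernel w s (p n) (p m)))"
proof -
  let ?v = "\<lambda>j. cosine_weight (c j)"
  interpret v: fourier_weights ?v by (rule fourier_weights_cosine) (rule c)
  have eq: "Re (fourier_kernel ?v s x y) = (\<Prod>j<s. 1 + 2 * c j * cos (2 * pi * (x j - y j)))" for x y
    unfolding v.fourier_kernel_eq_prod fourier_series_cosine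
    by (simp only: of_real_prod[symmetric] Re_complex_of_real)
  have factor: "0 \<le> 1 + 2 * c j * cos t" for j t
  proof -
    have "\<bar>2 * c j * cos t\<bar> \<le> 1 * 1"
      unfolding abs_mult using c(1,2)[of j] by (intro mult_mono) auto
    then show ?thesis by linarith
  qed
  have "real N * (\<Prod>j<s. 1 + 2 * c j) = (\<Sum>n<N. Re (fourier_kernel ?v s (p n) (p n)))"
    by (simp add: eq)
  also have "\<dots> \<le> (\<Sum>n<N. \<Sum>m<N. Re (fourier_kernel ?v s (p n) (p m)))"
    by (intro sum_mono member_le_sum) (auto simp: eq intro!: prod_nonneg factor)
  also have "\<dots> \<le> (\<Sum>n<N. \<Sum>m<N. Re (fourier_kernel w s (p n) (p m)))"
  proof (rule sum_fourier_kernel_mono[OF w v.fourier_weights_axioms])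
    fix j k
    show "?v j k \<le> w j k"
      using c(3,4)[of j] fourier_weights.weight_nonneg[OF w, of j k]
        fourier_weights.weight_zero[OF w, of j]
      by (cases "k = 1 \<or> k = -1") (auto simp: cosine_weight_def)
  qed
  finally show ?thesis .
qed

section \<open>Spaces with a Fourier kernel\<close>

locale fourier_rkhs = fourier_weights w + rkhs "unit_cube s" "fourier_kernel w s" H
  for w :: "nat \<Rightarrow> int \<Rightarrow> real" and s :: nat and H :: "(nat \<Rightarrow> real) fun_space"
begin

text \<open>Functions in the space are continuous, since
  \<open>\<bar>f x - f y\<bar> \<le> \<parallel>f\<parallel> \<parallel>K\<^sub>x - K\<^sub>y\<parallel>\<close> and the kernel is continuous. They live on the closed cube inside
  the function space \<open>nat \<Rightarrow> real\<close>; composing with the clamping map extends \<open>f\<close> to a continuous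
  function on all of that space, so that Borel measurability follows.\<close>

lemma continuous_on_clamped_fn:
  assumes f: "f \<in> fns H"
  shows "continuous_on UNIV (\<lambda>z. f (\<lambda>j\<in>{..<s}. max 0 (min 1 (z j))))"
proof -
  define \<phi> :: "(nat \<Rightarrow> real) \<Rightarrow> nat \<Rightarrow> real" where "\<phi> z = (\<lambda>j\<in>{..<s}. max 0 (min 1 (z j)))" for z
  let ?D = "\<Prod>j<s. \<Sum>\<^sub>\<infinity>k. w j k"
  let ?K = "kernel_section (unit_cube s) (fourier_kernel w s)"
  have \<phi>: "\<phi> z \<in> unit_cube s" for z by (auto simp: \<phi>_def unit_cube_def)
  have eq: "fourier_kernel w s (\<phi> z') (\<phi> z)
      = (\<Prod>j<s. fourier_series (w j) (max 0 (min 1 (z' j)) - max 0 (min 1 (z j))))" for z z'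
    unfolding fourier_kernel_eq_prod by (rule prod.cong) (auto simp: \<phi>_def)
  have le: "norm (f (\<phi> z') - f (\<phi> z))
      \<le> hnorm H f * sqrt (2 * ?D - 2 * Re (fourier_kernel w s (\<phi> z') (\<phi> z)))" for z z'
  proof -
    have K: "?K (\<phi> z) \<in> fns H" for z by (rule section_closed[OF \<phi>])
    have sq: "(hnorm H (?K (\<phi> z)))\<^sup>2 = ?D" for z
    proof -
      have "complex_of_real ((hnorm H (?K (\<phi> z)))\<^sup>2) = complex_of_real ?D"
        unfolding ip_self[OF K, symmetric]
        using reproducing[OF K \<phi>, of z z, symmetric] \<phi>[of z] fourier_kernel_diagonal
        by (simp add: kernel_section_def)
      then show ?thesis by (simp only: of_real_eq_iff)
    qed
    have "(hnorm H (\<lambda>x. ?K (\<phi> z) x - ?K (\<phi> z') x))\<^sup>2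
        = 2 * ?D - 2 * Re (fourier_kernel w s (\<phi> z') (\<phi> z))"
      using hnorm_diff_sq[OF K K, of z z'] sq[of z] sq[of z']
        reproducing[OF K \<phi>, of z z'] \<phi>[of z'] by (simp add: kernel_section_def)
    then have norm: "hnorm H (\<lambda>x. ?K (\<phi> z) x - ?K (\<phi> z') x)
        = sqrt (2 * ?D - 2 * Re (fourier_kernel w s (\<phi> z') (\<phi> z)))"
      using hnorm_nonneg[OF diff_closed[OF K K]] by (intro real_sqrt_unique[symmetric])
    have "norm (f (\<phi> z') - f (\<phi> z)) = norm (ip H f (\<lambda>x. ?K (\<phi> z) x - ?K (\<phi> z') x))"
      using reproducing[OF f \<phi>] ip_diff_right[OF K K f] by (simp add: norm_minus_commute)
    then show ?thesis using Cauchy_Schwarz[OF f diff_closed[OF K K], of z z'] norm by simp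
  qed
  have "(\<lambda>z. f (\<phi> z)) \<midarrow>z\<rightarrow> f (\<phi> z)" for z
  proof (rule Lim_null[THEN iffD2], rule Lim_null_comparison)
    define R where "R z' = hnorm H f * sqrt (2 * ?D - 2 * Re (fourier_kernel w s (\<phi> z') (\<phi> z)))" for z'
    have "continuous_on UNIV R"
      unfolding R_def eq
      by (intro continuous_intros continuous_on_product_coordinates
          continuous_on_compose2[OF continuous_fourier_series[OF weight_nonneg weight_summable]]) auto
    moreover have "R z = 0" by (simp add: R_def Re_fourier_kernel_diagonal)
    ultimately show "R \<midarrow>z\<rightarrow> 0"
      by (metis UNIV_I continuous_on_def open_UNIV at_within_open)
    show "\<forall>\<^sub>F z' in at z. norm (f (\<phi> z') - f (\<phi> z)) \<le> R z'"
      by (simp add: R_def le)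
  qed
  then show ?thesis by (simp add: \<phi>_def[symmetric] continuous_on_def)
qed

lemma fn_measurable:
  assumes f: "f \<in> fns H"
  shows "f \<in> borel_measurable (cube_measure s)"
proof -
  have "(\<lambda>x. x) \<in> borel_measurable (cube_measure s)"
  proof (rule measurable_coordinatewise_then_product)
    fix i
    show "(\<lambda>x. x i) \<in> borel_measurable (cube_measure s)"
    proof (cases "i < s")
      case True
      then have "(\<lambda>x. x i) \<in> measurable (cube_measure s) unit_interval"
        unfolding cube_measure_def by (intro measurable_component_singleton) simp
      moreover have "(\<lambda>t. t) \<in> borel_measurable unit_interval"
        by (intro measurable_restrict_space1) simp
      ultimately show ?thesis by (rule measurable_compose)
    next
      case False
      then show ?thesis
        by (subst measurable_cong[of _ _ "\<lambda>_. undefined"])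
          (auto simp: space_cube_measure unit_cube_def PiE_def extensional_def)
    qed
  qed
  then have "(\<lambda>x. f (\<lambda>j\<in>{..<s}. max 0 (min 1 (x j)))) \<in> borel_measurable (cube_measure s)"
    using borel_measurable_continuous_onI[OF continuous_on_clamped_fn[OF f]]
    by (rule measurable_compose)
  moreover have "f (\<lambda>j\<in>{..<s}. max 0 (min 1 (x j))) = f x" if "x \<in> space (cube_measure s)" for x
  proof -
    have "(\<lambda>j\<in>{..<s}. max 0 (min 1 (x j))) = x"
    proof
      fix j show "(\<lambda>j\<in>{..<s}. max 0 (min 1 (x j))) j = x j"
        using that by (cases "j < s")
          (auto simp: space_cube_measure unit_cube_def PiE_def Pi_def extensional_def)
    qed
    then show ?thesis by (rule arg_cong)
  qed
  ultimately show ?thesis by (simp cong: measurable_cong)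
qed

sublocale averaging_rkhs "unit_cube s" "fourier_kernel w s" H "cube_measure s"
  "\<Prod>j<s. \<Sum>\<^sub>\<infinity>k. w j k"
proof (intro averaging_rkhs.intro averaging_rkhs_axioms.intro rkhs_axioms prob_space_cube_measure
    space_cube_measure fn_measurable)
  fix y assume "y \<in> unit_cube s"
  have "(\<integral>x. kernel_section (unit_cube s) (fourier_kernel w s) y x \<partial>cube_measure s)
     = (\<integral>x. fourier_kernel w s x y \<partial>cube_measure s)"
    by (rule Bochner_Integration.integral_cong)
      (auto simp: kernel_section_def space_cube_measure)
  then show "(\<integral>x. kernel_section (unit_cube s) (fourier_kernel w s) y x \<partial>cube_measure s) = 1"
    by (simp add: integral_fourier_kernel)
next
  fix x
  show "Re (fourier_kernel w s x x) \<le> (\<Prod>j<s. \<Sum>\<^sub>\<infinity>k. w j k)"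
    by (rule eq_refl, rule Re_fourier_kernel_diagonal)
qed

lemma qmc_error_eq:
  assumes "N \<ge> 1" "\<And>n. n < N \<Longrightarrow> p n \<in> unit_cube s"
  shows "qmc_error H s N p
    = ennreal (sqrt ((\<Sum>n<N. \<Sum>m<N. Re (fourier_kernel w s (p n) (p m))) / (real N)\<^sup>2 - 1))"
  unfolding qmc_error_def by (rule SUP_integration_error[OF assms])

end

section \<open>Bounds for the minimal number of nodes\<close>

text \<open>In each coordinate the total weight of the nonzero frequencies is at most \<open>C * \<gamma> j\<close> and the weights
  of the frequencies \<open>1\<close> and \<open>-1\<close> are at least \<open>c * \<gamma> j\<close>. The condition \<open>c * \<gamma> j \<le> 1 / 2\<close> makes the
  cosine kernel with coefficients \<open>c * \<gamma> j\<close> nonnegative.\<close>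

locale weighted_integration = fourier_weights w
  for w :: "nat \<Rightarrow> int \<Rightarrow> real" +
  fixes H :: "nat \<Rightarrow> (nat \<Rightarrow> real) fun_space" and \<gamma> :: "nat \<Rightarrow> real" and C c :: real
  assumes spaces: "s \<ge> 1 \<Longrightarrow> rkhs (unit_cube s) (fourier_kernel w s) (H s)"
    and \<gamma>_pos: "0 < \<gamma> j"
    and C_nonneg: "0 \<le> C"
    and weight_sum_le: "(\<Sum>\<^sub>\<infinity>k. w j k) \<le> 1 + C * \<gamma> j"
    and c_pos: "0 < c"
    and c_le: "c * \<gamma> j \<le> 1 / 2"
    and weight_ge: "c * \<gamma> j \<le> w j 1" "c * \<gamma> j \<le> w j (- 1)"
begin

lemma spaces_fourier_rkhs: "s \<ge> 1 \<Longrightarrow> fourier_rkhs w s (H s)"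
  by (intro fourier_rkhs.intro spaces fourier_weights_axioms)

lemma initial_error_eq_1:
  assumes s: "s \<ge> 1"
  shows "initial_error H s = 1"
proof -
  interpret fourier_rkhs w s "H s" by (rule spaces_fourier_rkhs[OF s])
  show ?thesis unfolding initial_error_def by (rule SUP_integral)
qed

text \<open>Greedy nodes have squared error at most \<open>K(x,x) / N\<close>, and
  \<open>K(x,x) \<le> (\<Prod>j<s. 1 + C * \<gamma> j) \<le> exp (C * (\<Sum>j<s. \<gamma> j))\<close>.\<close>

lemma min_error_le:
  assumes s: "s \<ge> 1" and \<epsilon>: "\<epsilon> > 0" and N: "N \<ge> 1" "exp (C * (\<Sum>j<s. \<gamma> j)) / \<epsilon>\<^sup>2 \<le> real N"
  shows "min_error H N s \<le> ennreal \<epsilon>"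
proof -
  interpret fourier_rkhs w s "H s" by (rule spaces_fourier_rkhs[OF s])
  let ?B = "\<Prod>j<s. \<Sum>\<^sub>\<infinity>k. w j k"
  have "?B \<le> (\<Prod>j<s. exp (C * \<gamma> j))"
    by (intro prod_mono conjI infsum_nonneg weight_nonneg
        order_trans[OF weight_sum_le exp_ge_add_one_self])
  also have "\<dots> = exp (C * (\<Sum>j<s. \<gamma> j))" by (simp add: exp_sum sum_distrib_left)
  finally have B: "?B \<le> exp (C * (\<Sum>j<s. \<gamma> j))" .
  obtain p where p: "\<And>n. p n \<in> unit_cube s"
    "(\<Sum>n<N. \<Sum>m<N. Re (fourier_kernel w s (p n) (p m))) / (real N)\<^sup>2 - 1 \<le> (?B - 1) / real N"
    using ex_small_error[OF N(1)] by blast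
  have "exp (C * (\<Sum>j<s. \<gamma> j)) \<le> \<epsilon>\<^sup>2 * real N"
    using N(2) \<epsilon> by (simp add: divide_le_eq mult.commute)
  then have "(?B - 1) / real N \<le> \<epsilon>\<^sup>2"
    using B N(1) by (simp add: divide_le_eq)
  then have "sqrt ((\<Sum>n<N. \<Sum>m<N. Re (fourier_kernel w s (p n) (p m))) / (real N)\<^sup>2 - 1) \<le> \<epsilon>"
    using p(2) \<epsilon> by (intro real_le_lsqrt) auto
  then have "qmc_error (H s) s N p \<le> ennreal \<epsilon>"
    using qmc_error_eq[of N p, OF N(1) p(1)] by (simp add: ennreal_leI)
  then show ?thesis unfolding min_error_def using p(1) by (intro INF_lower2[of p]) auto
qed

lemma prod_ge_exp: "exp (c * (\<Sum>j<s. \<gamma> j)) \<le> (\<Prod>j<s. 1 + 2 * (c * \<gamma> j))"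
proof -
  have "exp (c * \<gamma> j) \<le> 1 + 2 * (c * \<gamma> j)" for j
  proof -
    let ?x = "c * \<gamma> j"
    have x: "0 \<le> ?x" "?x \<le> 1" using c_pos \<gamma>_pos[of j] c_le[of j] by auto
    have "?x\<^sup>2 \<le> ?x" unfolding power2_eq_square using x by (intro mult_left_le) auto
    then show ?thesis using exp_bound[OF x] by simp
  qed
  then have "(\<Prod>j<s. exp (c * \<gamma> j)) \<le> (\<Prod>j<s. 1 + 2 * (c * \<gamma> j))"
    by (intro prod_mono) auto
  then show ?thesis by (simp add: exp_sum sum_distrib_left)
qed

text \<open>Every set of \<open>N\<close> nodes has squared error at least
  \<open>(\<Prod>j<s. 1 + 2 * c * \<gamma> j) / N - 1\<close>.\<close>

lemma card_ge_of_min_error_le: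
  assumes s: "s \<ge> 1" and N: "N \<ge> 1" and \<epsilon>: "0 \<le> \<epsilon>" "\<epsilon> \<le> 1" and le: "min_error H N s \<le> ennreal \<epsilon>"
  shows "exp (c * (\<Sum>j<s. \<gamma> j)) / 2 \<le> real N"
proof -
  interpret fourier_rkhs w s "H s" by (rule spaces_fourier_rkhs[OF s])
  let ?E = "exp (c * (\<Sum>j<s. \<gamma> j))"
  have "ennreal (sqrt (?E / real N - 1)) \<le> min_error H N s"
    unfolding min_error_def
  proof (rule INF_greatest)
    fix p assume p: "p \<in> {..<N} \<rightarrow> unit_cube s"
    have "real N * ?E \<le> real N * (\<Prod>j<s. 1 + 2 * (c * \<gamma> j))"
      by (intro mult_left_mono prod_ge_exp) simp
    also have "\<dots> \<le> (\<Sum>n<N. \<Sum>m<N. Re (fourier_kernel w s (p n) (p m)))"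
      using sum_kernel_ge_diagonal[OF fourier_weights_axioms, of "\<lambda>j. c * \<gamma> j"]
        c_pos \<gamma>_pos c_le weight_ge by (simp add: less_imp_le)
    finally have "real N * ?E / (real N)\<^sup>2
        \<le> (\<Sum>n<N. \<Sum>m<N. Re (fourier_kernel w s (p n) (p m))) / (real N)\<^sup>2"
      by (rule divide_right_mono) simp
    then have "?E / real N \<le> (\<Sum>n<N. \<Sum>m<N. Re (fourier_kernel w s (p n) (p m))) / (real N)\<^sup>2"
      using N by (simp add: power2_eq_square)
    then show "ennreal (sqrt (?E / real N - 1)) \<le> qmc_error (H s) s N p"
      using qmc_error_eq[of N p, OF N] p by (auto intro!: ennreal_leI simp: Pi_iff)
  qed
  then have "sqrt (?E / real N - 1) \<le> 1"
    using le \<epsilon> by (metis ennreal_le_iff order_trans)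
  then have "?E / real N \<le> 2" by simp
  then show ?thesis using N by (simp add: divide_le_eq mult.commute)
qed

lemma N_min_bounds:
  assumes s: "s \<ge> 1" and \<epsilon>: "0 < \<epsilon>" "\<epsilon> < 1"
  shows "real (N_min H \<epsilon> s) \<le> 2 * exp (C * (\<Sum>j<s. \<gamma> j)) * \<epsilon> powr (- 2)"
    and "exp (c * (\<Sum>j<s. \<gamma> j)) / 2 \<le> real (N_min H \<epsilon> s)"
    and "1 \<le> N_min H \<epsilon> s"
proof -
  define R where "R = exp (C * (\<Sum>j<s. \<gamma> j)) / \<epsilon>\<^sup>2"
  have "0 \<le> C * (\<Sum>j<s. \<gamma> j)" using C_nonneg \<gamma>_pos by (intro mult_nonneg_nonneg sum_nonneg) (auto intro: less_imp_le)
  moreover have "\<epsilon>\<^sup>2 \<le> 1" using \<epsilon> by (simp add: power_le_one)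
  ultimately have R: "1 \<le> R" using \<epsilon> unfolding R_def
    by (subst le_divide_eq) (auto intro: order_trans[OF _ one_le_exp_iff[THEN iffD2]])
  define N where "N = nat \<lceil>R\<rceil>"
  have N: "R \<le> real N" "real N \<le> R + 1" "N \<ge> 1" using R unfolding N_def by linarith+
  let ?P = "\<lambda>N. N \<ge> 1 \<and> min_error H N s \<le> ennreal \<epsilon> * initial_error H s"
  have P: "?P N" using min_error_le[OF s \<epsilon>(1) N(3)] N R_def initial_error_eq_1[OF s] by simp
  then have "N_min H \<epsilon> s \<le> N" unfolding N_min_def by (rule Least_le)
  then have "real (N_min H \<epsilon> s) \<le> R + 1" using N(2) by linarith
  also have "\<dots> \<le> 2 * R" using R by simp
  also have "R = exp (C * (\<Sum>j<s. \<gamma> j)) * \<epsilon> powr (- 2)"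
    using \<epsilon> by (simp add: R_def powr_minus divide_inverse powr_numeral)
  finally show "real (N_min H \<epsilon> s) \<le> 2 * exp (C * (\<Sum>j<s. \<gamma> j)) * \<epsilon> powr (- 2)" by simp
  have "?P (N_min H \<epsilon> s)" unfolding N_min_def using P by (rule LeastI)
  then show "1 \<le> N_min H \<epsilon> s" "exp (c * (\<Sum>j<s. \<gamma> j)) / 2 \<le> real (N_min H \<epsilon> s)"
    using card_ge_of_min_error_le[OF s, of "N_min H \<epsilon> s" \<epsilon>] initial_error_eq_1[OF s] \<epsilon> by auto
qed

section \<open>Tractability in terms of the sums of the weights\<close>

definition gamma_sum :: "nat \<Rightarrow> real" where "gamma_sum s = (\<Sum>j<s. \<gamma> j)"

lemma gamma_sum_nonneg: "0 \<le> gamma_sum s"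
  unfolding gamma_sum_def using \<gamma>_pos by (intro sum_nonneg less_imp_le)

lemma gamma_sum_mono: "s \<le> t \<Longrightarrow> gamma_sum s \<le> gamma_sum t"
  unfolding gamma_sum_def using \<gamma>_pos by (intro sum_mono2) (auto intro: less_imp_le)

text \<open>For necessity it suffices to look at the single accuracy \<open>\<epsilon> = 1 / 2\<close>.\<close>

lemma gamma_sum_le_of_N_min_bound:
  assumes "N_min_bound H a p q" "s \<ge> 1"
  shows "c * gamma_sum s \<le> ln (2 * a * 2 powr p) + q * ln (real s)"
proof -
  have "exp (c * gamma_sum s) / 2 \<le> real (N_min H (1 / 2) s)"
    unfolding gamma_sum_def using N_min_bounds(2)[OF assms(2), of "1/2"] by simp
  also have "\<dots> \<le> a * real s powr q * (1 / 2) powr (- p)"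
    using assms unfolding N_min_bound_def by (auto dest!: bspec[of _ _ "1/2"])
  also have "(1 / 2 :: real) powr (- p) = 2 powr p"
    by (simp add: powr_divide powr_minus)
  finally have le: "exp (c * gamma_sum s) \<le> (2 * a * 2 powr p) * real s powr q"
    by (simp add: mult_ac)
  then have "0 < (2 * a * 2 powr p) * real s powr q"
    using exp_gt_zero less_le_trans by blast
  then have a: "0 < a" using assms(2) by (simp add: zero_less_mult_iff)
  have "c * gamma_sum s \<le> ln ((2 * a * 2 powr p) * real s powr q)"
    using le a assms(2) by (subst ln_ge_iff) auto
  also have "\<dots> = ln (2 * a * 2 powr p) + q * ln (real s)"
    using a assms(2) by (subst ln_mult) (auto simp: ln_powr)
  finally show ?thesis .
qed

text \<open>The three equivalences are read off from \<open>exp (c * S) / 2 \<le> N_min \<le> 2 * exp (C * S) / \<epsilon>\<^sup>2\<close> with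
  \<open>S = gamma_sum s\<close>. The powers of \<open>\<epsilon>\<close> are harmless: \<open>p = 2\<close> serves for polynomial
  tractability, and \<open>ln (1 / \<epsilon>) / (s + 1 / \<epsilon>)\<close> tends to \<open>0\<close>.\<close>

lemma strongly_tractable_iff: "strongly_polynomially_QMC_tractable H \<longleftrightarrow> summable \<gamma>"
proof
  assume "strongly_polynomially_QMC_tractable H"
  then obtain a p where b: "N_min_bound H a p 0"
    unfolding strongly_polynomially_QMC_tractable_def by blast
  show "summable \<gamma>"
  proof (rule bounded_imp_summable)
    fix n
    have "c * gamma_sum (Suc n) \<le> ln (2 * a * 2 powr p)"
      using gamma_sum_le_of_N_min_bound[OF b, of "Suc n"] by simp
    then show "(\<Sum>k\<le>n. \<gamma> k) \<le> ln (2 * a * 2 powr p) / c"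
      using c_pos by (simp add: gamma_sum_def lessThan_Suc_atMost field_simps)
  qed (rule less_imp_le[OF \<gamma>_pos])
next
  assume sum: "summable \<gamma>"
  have "N_min_bound H (2 * exp (C * suminf \<gamma>)) 2 0"
    unfolding N_min_bound_def
  proof (intro ballI allI impI)
    fix \<epsilon> :: real and s :: nat assume *: "\<epsilon> \<in> {0<..<1}" "1 \<le> s"
    have "gamma_sum s \<le> suminf \<gamma>"
      unfolding gamma_sum_def by (rule sum_le_suminf[OF sum]) (auto intro: less_imp_le \<gamma>_pos)
    then have "exp (C * gamma_sum s) \<le> exp (C * suminf \<gamma>)" using C_nonneg by (simp add: mult_left_mono)
    then have "2 * exp (C * gamma_sum s) * \<epsilon> powr (- 2) \<le> 2 * exp (C * suminf \<gamma>) * \<epsilon> powr (- 2)"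
      by (intro mult_right_mono) auto
    moreover have "real (N_min H \<epsilon> s) \<le> 2 * exp (C * gamma_sum s) * \<epsilon> powr (- 2)"
      using N_min_bounds(1)[of s \<epsilon>] * by (simp add: gamma_sum_def)
    ultimately have "real (N_min H \<epsilon> s) \<le> 2 * exp (C * suminf \<gamma>) * \<epsilon> powr (- 2)"
      by linarith
    then show "real (N_min H \<epsilon> s) \<le> 2 * exp (C * suminf \<gamma>) * real s powr 0 * \<epsilon> powr (- 2)"
      using * by simp
  qed
  then show "strongly_polynomially_QMC_tractable H"
    unfolding strongly_polynomially_QMC_tractable_def
    by (intro exI[of _ "2 * exp (C * suminf \<gamma>)"] exI[of _ 2] conjI) auto
qed

lemma polynomially_tractable_iff:
  "polynomially_QMC_tractable H \<longleftrightarrow> limsup (\<lambda>s. ereal (gamma_sum s / ln (real s))) < \<infinity>"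
proof
  assume "polynomially_QMC_tractable H"
  then obtain a p q where q: "q \<ge> 0" and b: "N_min_bound H a p q"
    unfolding polynomially_QMC_tractable_def by blast
  define L where "L = ln (2 * a * 2 powr p)"
  have "gamma_sum s / ln (real s) \<le> (\<bar>L\<bar> + q) / c" if s: "s \<ge> 3" for s
  proof -
    have "ln 3 \<le> ln (real s)" using s by simp
    then have ln: "1 \<le> ln (real s)" using ln3_gt_1 by linarith
    have "c * gamma_sum s \<le> L + q * ln (real s)" using gamma_sum_le_of_N_min_bound[OF b, of s] s by (simp add: L_def)
    also have "\<dots> \<le> \<bar>L\<bar> * ln (real s) + q * ln (real s)"
      using ln mult_left_mono[OF ln, of "\<bar>L\<bar>"] by simp
    finally have "c * gamma_sum s \<le> (\<bar>L\<bar> + q) * ln (real s)" by (simp add: algebra_simps)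
    then show ?thesis using ln c_pos by (simp add: field_simps)
  qed
  then have "limsup (\<lambda>s. ereal (gamma_sum s / ln (real s))) \<le> ereal ((\<bar>L\<bar> + q) / c)"
    by (intro Limsup_bounded eventually_sequentiallyI[of 3]) simp
  then show "limsup (\<lambda>s. ereal (gamma_sum s / ln (real s))) < \<infinity>"
    using le_less_trans by fastforce
next
  assume "limsup (\<lambda>s. ereal (gamma_sum s / ln (real s))) < \<infinity>"
  then obtain n :: nat where "limsup (\<lambda>s. ereal (gamma_sum s / ln (real s))) < ereal (real n)"
    using less_PInf_Ex_of_nat by auto
  then obtain M :: real where "limsup (\<lambda>s. ereal (gamma_sum s / ln (real s))) < ereal M" by blast
  then have "\<forall>\<^sub>F s in sequentially. ereal (gamma_sum s / ln (real s)) < ereal M"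
    by (rule Limsup_lessD)
  then obtain s0 where s0: "\<And>s. s \<ge> s0 \<Longrightarrow> gamma_sum s / ln (real s) < M"
    by (auto simp: eventually_sequentially)
  define s1 where "s1 = max s0 3"
  have le: "gamma_sum s \<le> gamma_sum s1 + \<bar>M\<bar> * ln (real s)" if s: "s \<ge> 1" for s
  proof (cases "s \<ge> s1")
    case True
    then have "0 < ln (real s)" by (simp add: s1_def)
    then have "gamma_sum s \<le> M * ln (real s)" using s0[of s] True by (simp add: s1_def divide_less_eq)
    also have "\<dots> \<le> \<bar>M\<bar> * ln (real s)" using \<open>0 < ln (real s)\<close> by (intro mult_right_mono) auto
    finally show ?thesis using gamma_sum_nonneg[of s1] by simp
  next
    case False
    then have "gamma_sum s \<le> gamma_sum s1" by (intro gamma_sum_mono) simp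
    moreover have "0 \<le> \<bar>M\<bar> * ln (real s)" using s by simp
    ultimately show ?thesis by simp
  qed
  have "N_min_bound H (2 * exp (C * gamma_sum s1)) 2 (C * \<bar>M\<bar>)"
    unfolding N_min_bound_def
  proof (intro ballI allI impI)
    fix \<epsilon> :: real and s :: nat assume *: "\<epsilon> \<in> {0<..<1}" "1 \<le> s"
    have "exp (C * gamma_sum s) \<le> exp (C * (gamma_sum s1 + \<bar>M\<bar> * ln (real s)))"
      using C_nonneg le[OF *(2)] by (simp add: mult_left_mono)
    also have "\<dots> = exp (C * gamma_sum s1) * real s powr (C * \<bar>M\<bar>)"
      using * by (simp add: powr_def exp_add[symmetric] algebra_simps)
    finally have "2 * exp (C * gamma_sum s) * \<epsilon> powr (- 2)
        \<le> 2 * (exp (C * gamma_sum s1) * real s powr (C * \<bar>M\<bar>)) * \<epsilon> powr (- 2)"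
      by (intro mult_right_mono mult_left_mono) auto
    moreover have "real (N_min H \<epsilon> s) \<le> 2 * exp (C * gamma_sum s) * \<epsilon> powr (- 2)"
      using N_min_bounds(1)[of s \<epsilon>] * by (simp add: gamma_sum_def)
    ultimately show "real (N_min H \<epsilon> s) \<le> 2 * exp (C * gamma_sum s1) * real s powr (C * \<bar>M\<bar>) * \<epsilon> powr (- 2)"
      by (simp only: mult.assoc)
  qed
  then show "polynomially_QMC_tractable H"
    unfolding polynomially_QMC_tractable_def using C_nonneg
    by (intro exI[of _ "2 * exp (C * gamma_sum s1)"] exI[of _ 2] exI[of _ "C * \<bar>M\<bar>"] conjI) auto
qed

lemma weakly_tractable_iff:
  "weakly_QMC_tractable H \<longleftrightarrow> (\<lambda>s. gamma_sum s / real s) \<longlonglongrightarrow> 0"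
proof
  let ?F = "inf (filtercomap (\<lambda>(s, \<epsilon>). real s + inverse \<epsilon>) at_top) (principal ({1..} \<times> {0<..<1}))"
  assume "weakly_QMC_tractable H"
  then have "((\<lambda>(s, \<epsilon>). ln (real (N_min H \<epsilon> s)) / (real s + inverse \<epsilon>)) \<longlongrightarrow> 0) ?F"
    unfolding weakly_QMC_tractable_def .
  moreover have "filterlim (\<lambda>s. (s, 1 / 2)) ?F sequentially"
    unfolding filterlim_inf filterlim_principal filterlim_filtercomap_iff
  proof
    show "filterlim ((\<lambda>(s, \<epsilon>). real s + inverse \<epsilon>) \<circ> (\<lambda>s. (s, 1 / 2))) at_top sequentially"
      unfolding o_def by (simp, real_asymp)
    show "\<forall>\<^sub>F s in sequentially. (s, 1 / 2) \<in> {1..} \<times> {0<..<1::real}"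
      by (intro eventually_sequentiallyI[of 1]) auto
  qed
  ultimately have lim_half: "((\<lambda>s. ln (real (N_min H (1 / 2) s)) / (real s + 2)) \<longlongrightarrow> 0) sequentially"
    using tendsto_compose_filtermap filterlim_compose by fastforce
  have "(\<lambda>s. (real s + 2) / real s) \<longlonglongrightarrow> 1" "(\<lambda>s. ln 2 / real s) \<longlonglongrightarrow> 0"
    by real_asymp+
  then have lim: "(\<lambda>s. (ln (real (N_min H (1 / 2) s)) / (real s + 2) * ((real s + 2) / real s)
      + ln 2 / real s) / c) \<longlonglongrightarrow> (0 * 1 + 0) / c"
    using c_pos by (intro tendsto_divide tendsto_add tendsto_mult lim_half tendsto_const) auto
  \<comment> \<open>at \<open>\<epsilon> = 1 / 2\<close> one has \<open>c * gamma_sum s \<le> ln N_min + ln 2\<close>, and \<open>s + 2\<close> is comparable to \<open>s\<close>\<close>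
  show "(\<lambda>s. gamma_sum s / real s) \<longlonglongrightarrow> 0"
  proof (rule tendsto_sandwich[OF _ _ tendsto_const])
    show "(\<lambda>s. (ln (real (N_min H (1 / 2) s)) / (real s + 2) * ((real s + 2) / real s)
      + ln 2 / real s) / c) \<longlonglongrightarrow> 0" using lim by simp
    show "\<forall>\<^sub>F s in sequentially. 0 \<le> gamma_sum s / real s" by (simp add: gamma_sum_nonneg)
    have "gamma_sum s / real s \<le> (ln (real (N_min H (1 / 2) s)) / (real s + 2) * ((real s + 2) / real s)
      + ln 2 / real s) / c" if s: "s \<ge> 1" for s
    proof -
      have "exp (c * gamma_sum s) / 2 \<le> real (N_min H (1 / 2) s)"
        unfolding gamma_sum_def using N_min_bounds(2)[OF s, of "1/2"] by simp
      then have "ln (exp (c * gamma_sum s) / 2) \<le> ln (real (N_min H (1 / 2) s))"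
        by (intro ln_mono) auto
      then have "c * gamma_sum s \<le> ln (real (N_min H (1 / 2) s)) + ln 2" by (simp add: ln_div)
      then have "c * gamma_sum s / real s \<le> (ln (real (N_min H (1 / 2) s)) + ln 2) / real s"
        by (rule divide_right_mono) simp
      also have "\<dots> = ln (real (N_min H (1 / 2) s)) / (real s + 2) * ((real s + 2) / real s)
          + ln 2 / real s"
      proof -
        have "a / b * (b / d) = a / d" if "b \<noteq> 0" for a b d :: real using that by simp
        from this[of "real s + 2"] show ?thesis by (simp only: add_divide_distrib)
      qed
      finally show ?thesis using c_pos by (simp add: le_divide_eq mult.commute)
    qed
    then show "\<forall>\<^sub>F s in sequentially. gamma_sum s / real s
      \<le> (ln (real (N_min H (1 / 2) s)) / (real s + 2) * ((real s + 2) / real s) + ln 2 / real s) / c"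
      by (intro eventually_sequentiallyI[of 1]) auto
  qed
next
  let ?t = "\<lambda>(s :: nat, \<epsilon> :: real). real s + inverse \<epsilon>"
  assume lim: "(\<lambda>s. gamma_sum s / real s) \<longlonglongrightarrow> 0"
  show "weakly_QMC_tractable H"
    unfolding weakly_QMC_tractable_def
  proof (rule tendstoI)
    fix e :: real assume e: "e > 0"
    define \<delta> where "\<delta> = e / (2 * (C + 1))"
    have \<delta>: "\<delta> > 0" "C * \<delta> \<le> e / 2"
      using e C_nonneg by (simp_all add: \<delta>_def field_simps)
    obtain s0 where s0: "\<And>s. s \<ge> s0 \<Longrightarrow> gamma_sum s / real s < \<delta>"
      using order_tendstoD(2)[OF lim \<delta>(1)] by (auto simp: eventually_sequentially)
    have S: "gamma_sum s \<le> gamma_sum s0 + \<delta> * real s" if "s \<ge> 1" for s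
    proof (cases "s \<ge> s0")
      case True
      then have "gamma_sum s \<le> \<delta> * real s" using s0[of s] that by (simp add: divide_less_eq)
      then show ?thesis using gamma_sum_nonneg[of s0] by simp
    next
      case False
      then have "gamma_sum s \<le> gamma_sum s0" by (intro gamma_sum_mono) simp
      moreover have "0 \<le> \<delta> * real s" using \<delta>(1) by simp
      ultimately show ?thesis by linarith
    qed
    define L where "L = ln 2 + C * gamma_sum s0"
    have "((\<lambda>t::real. L / t + 2 * ln t / t) \<longlongrightarrow> 0) at_top" by real_asymp
    then have "\<forall>\<^sub>F t in at_top. L / t + 2 * ln t / t < e / 2"
      using e by (intro order_tendstoD) auto
    then have "\<forall>\<^sub>F x in filtercomap ?t at_top. L / ?t x + 2 * ln (?t x) / ?t x < e / 2"
      by (rule eventually_filtercomapI)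
    then show "\<forall>\<^sub>F x in inf (filtercomap ?t at_top) (principal ({1..} \<times> {0<..<1})).
        dist (case x of (s, \<epsilon>) \<Rightarrow> ln (real (N_min H \<epsilon> s)) / (real s + inverse \<epsilon>)) 0 < e"
      unfolding eventually_inf_principal
    proof (elim eventually_mono, intro impI)
      fix x :: "nat \<times> real"
      assume small: "L / ?t x + 2 * ln (?t x) / ?t x < e / 2" and x: "x \<in> {1..} \<times> {0<..<1}"
      obtain s \<epsilon> where s\<epsilon>: "x = (s, \<epsilon>)" by (cases x)
      define t where "t = real s + inverse \<epsilon>"
      have s: "s \<ge> 1" and \<epsilon>: "\<epsilon> \<in> {0<..<1}" and small: "L / t + 2 * ln t / t < e / 2"
        using x small by (simp_all add: s\<epsilon> t_def)
      have t: "t > 0" "inverse \<epsilon> \<le> t" "real s \<le> t"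
        using \<epsilon> by (auto simp: t_def add_nonneg_pos)
      let ?N = "real (N_min H \<epsilon> s)"
      have N1: "1 \<le> ?N" using N_min_bounds(3)[OF s] \<epsilon> by simp
      have "?N \<le> 2 * exp (C * gamma_sum s) * \<epsilon> powr (- 2)"
        using N_min_bounds(1)[OF s] \<epsilon> by (simp add: gamma_sum_def)
      then have "ln ?N \<le> ln (2 * exp (C * gamma_sum s) * \<epsilon> powr (- 2))"
        using N1 by (intro ln_mono) auto
      also have "\<dots> = ln 2 + C * gamma_sum s + 2 * ln (inverse \<epsilon>)"
        using \<epsilon> by (simp add: ln_mult ln_powr ln_inverse)
      also have "\<dots> \<le> ln 2 + C * (gamma_sum s0 + \<delta> * real s) + 2 * ln t"
        using S[OF s] t \<epsilon> C_nonneg by (intro add_mono mult_left_mono ln_mono) auto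
      also have "\<dots> = L + (C * \<delta>) * real s + 2 * ln t" by (simp add: L_def algebra_simps)
      also have "\<dots> \<le> L + (e / 2) * t + 2 * ln t"
        using \<delta>(2) t(3) e by (intro add_mono mult_mono order_refl) auto
      finally have "ln ?N / t \<le> (L + (e / 2) * t + 2 * ln t) / t"
        using t(1) by (intro divide_right_mono) auto
      also have "\<dots> = L / t + 2 * ln t / t + e / 2"
        using t(1) by (simp add: add_divide_distrib)
      also have "\<dots> < e" using small by linarith
      finally have "ln ?N / t < e" .
      moreover have "0 \<le> ln ?N / t" using N1 t(1) by simp
      ultimately show "dist (case x of (s, \<epsilon>) \<Rightarrow> ln (real (N_min H \<epsilon> s)) / (real s + inverse \<epsilon>)) 0 < e"
        by (simp add: s\<epsilon> t_def[symmetric])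
    qed
  qed
qed

end

section \<open>Korobov and log-Korobov spaces\<close>

lemma summable_on_int_abs:
  fixes u :: "nat \<Rightarrow> real"
  assumes "summable u" "\<And>n. 0 \<le> u n"
  shows "(\<lambda>k::int. u (nat \<bar>k\<bar>)) summable_on UNIV"
proof -
  have u: "u summable_on UNIV" by (rule summable_nonneg_imp_summable_on) (use assms in auto)
  have "(\<lambda>k::int. u (nat \<bar>k\<bar>)) summable_on (range int)"
    by (subst summable_on_reindex) (use u in \<open>auto simp: o_def\<close>)
  moreover have "(\<lambda>k::int. u (nat \<bar>k\<bar>)) summable_on (range (\<lambda>n. - int n))"
    by (subst summable_on_reindex) (use u in \<open>auto simp: o_def inj_on_def\<close>)
  then have "(\<lambda>k::int. u (nat \<bar>k\<bar>)) summable_on (range (\<lambda>n. - int n) - range int)"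
    by (rule summable_on_subset_banach) auto
  ultimately have "(\<lambda>k::int. u (nat \<bar>k\<bar>)) summable_on (range int \<union> (range (\<lambda>n. - int n) - range int))"
    by (rule summable_on_Un_disjoint) auto
  moreover have "range int \<union> (range (\<lambda>n. - int n) - range int) = UNIV"
    by (auto simp: image_iff) (metis int_cases2)
  ultimately show ?thesis by simp
qed

text \<open>Cauchy condensation turns the series into \<open>\<Sum>n. (ln \<kappa> + n ln 2) powr (- \<mu>)\<close>.\<close>

lemma summable_inverse_ln_powr:
  fixes \<kappa> \<mu> :: real
  assumes \<kappa>: "\<kappa> > 1" and \<mu>: "\<mu> > 1"
  shows "summable (\<lambda>n::nat. inverse (real n) * ln (\<kappa> * real n) powr (- \<mu>))"
proof -
  let ?f = "\<lambda>n::nat. inverse (real n) * ln (\<kappa> * real n) powr (- \<mu>)"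
  have "summable ?f \<longleftrightarrow> summable (\<lambda>n. 2 ^ n * ?f (2 ^ n))"
  proof (rule condensation_test)
    fix m :: nat assume m: "0 < m"
    have "1 < \<kappa> * real m" using \<kappa> m mult_strict_mono'[of 1 \<kappa> 1 "real m"]
      by (cases "m = 1") auto
    moreover have "\<kappa> * real m \<le> \<kappa> * real (Suc m)" using \<kappa> by simp
    ultimately have "0 < ln (\<kappa> * real m)" "ln (\<kappa> * real m) \<le> ln (\<kappa> * real (Suc m))"
      by auto
    then have "ln (\<kappa> * real (Suc m)) powr (- \<mu>) \<le> ln (\<kappa> * real m) powr (- \<mu>)"
      using \<mu> by (intro powr_mono2') auto
    then show "?f (Suc m) \<le> ?f m" using m by (intro mult_mono) auto
  qed auto
  also have "\<dots>"
  proof (rule summable_comparison_test')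
    show "summable (\<lambda>n. ln 2 powr (- \<mu>) * real n powr (- \<mu>))"
      using \<mu> by (intro summable_mult) (simp add: summable_real_powr_iff)
    fix n :: nat assume n: "1 \<le> n"
    have "ln (\<kappa> * 2 ^ n) = ln \<kappa> + real n * ln 2" using \<kappa> by (simp add: ln_mult ln_realpow)
    then have "ln 2 * real n \<le> ln (\<kappa> * 2 ^ n)" using \<kappa> by (simp add: mult.commute)
    then have "ln (\<kappa> * 2 ^ n) powr (- \<mu>) \<le> (ln 2 * real n) powr (- \<mu>)"
      using \<mu> n by (intro powr_mono2') auto
    moreover have "2 ^ n * ?f (2 ^ n) = ln (\<kappa> * 2 ^ n) powr (- \<mu>)"
      by (simp add: mult.assoc[symmetric])
    ultimately show "norm (2 ^ n * ?f (2 ^ n)) \<le> ln 2 powr (- \<mu>) * real n powr (- \<mu>)"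
      by (simp only: powr_mult) simp
  qed
  finally show ?thesis .
qed

text \<open>Both families of weights have this form, with \<open>\<gamma>\<close> bounded. An upper bound \<open>G\<close> for \<open>\<gamma>\<close> makes the
  constant \<open>c\<close> independent of the coordinate.\<close>

lemma weighted_integration_product:
  fixes v :: "int \<Rightarrow> real"
  assumes w: "\<And>j k. w j k = (if k = 0 then 1 else \<gamma> j * v k)"
    and v: "\<And>k. 0 \<le> v k" "v summable_on UNIV" "0 < v 1" "0 < v (- 1)"
    and \<gamma>: "\<And>j. 0 < \<gamma> j" "\<And>j. \<gamma> j \<le> G"
    and H: "\<And>s. s \<ge> 1 \<Longrightarrow> rkhs (unit_cube s) (fourier_kernel w s) (H s)"
  shows "weighted_integration w H \<gamma> (\<Sum>\<^sub>\<infinity>k. v k) (min (min (v 1) (v (- 1))) (1 / (2 * G)))"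
proof -
  have G: "G > 0" using \<gamma>[of 0] by linarith
  have delta: "((\<lambda>k::int. if k = 0 then 1 else 0 :: real) has_sum 1) UNIV"
    by (rule has_sum_finite_neutralI[of "{0}"]) auto
  have w': "w j k \<le> (if k = 0 then 1 else 0) + \<gamma> j * v k" for j k
    using w[of j k] v(1)[of k] \<gamma>(1)[of j] by (cases "k = 0") simp_all
  have maj: "((\<lambda>k. (if k = 0 then 1 else 0) + \<gamma> j * v k) has_sum (1 + \<gamma> j * (\<Sum>\<^sub>\<infinity>k. v k))) UNIV" for j
    using v(2) by (intro has_sum_add delta has_sum_cmult_right has_sum_infsum)
  have nonneg: "0 \<le> w j k" for j k
    using w[of j k] v(1)[of k] \<gamma>(1)[of j] by (cases "k = 0") simp_all
  have sum: "w j summable_on UNIV" for j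
    by (rule summable_on_comparison_test[OF has_sum_imp_summable[OF maj[of j]]]) (use w' nonneg in auto)
  define c where "c = min (min (v 1) (v (- 1))) (1 / (2 * G))"
  have c: "0 < c" "c \<le> v 1" "c \<le> v (- 1)" "c \<le> 1 / (2 * G)" using v G by (auto simp: c_def)
  show ?thesis unfolding c_def[symmetric]
  proof (intro weighted_integration.intro fourier_weights.intro weighted_integration_axioms.intro)
    show "s \<ge> 1 \<Longrightarrow> rkhs (unit_cube s) (fourier_kernel w s) (H s)" for s by (rule H)
    show "(\<Sum>\<^sub>\<infinity>k. w j k) \<le> 1 + (\<Sum>\<^sub>\<infinity>k. v k) * \<gamma> j" for j
      using has_sum_mono[OF has_sum_infsum[OF sum[of j]] maj[of j]] w' by (simp add: mult.commute)
    show "c * \<gamma> j \<le> 1 / 2" for j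
    proof -
      have "c * \<gamma> j \<le> 1 / (2 * G) * G"
        using c G \<gamma>(1)[of j] \<gamma>(2)[of j] by (intro mult_mono) auto
      then show ?thesis using G by simp
    qed
    show "c * \<gamma> j \<le> w j 1" "c * \<gamma> j \<le> w j (- 1)" for j
      using c \<gamma>(1)[of j] by (simp_all add: w mult.commute)
    show "0 \<le> (\<Sum>\<^sub>\<infinity>k. v k)" by (rule infsum_nonneg) (rule v)
  qed (use nonneg sum c \<gamma> w in auto)
qed

theorem theorem3:
  fixes \<alpha> \<mu> \<kappa> :: real and \<gamma> :: "nat \<Rightarrow> real"
    and H_kor H_log :: "nat \<Rightarrow> (nat \<Rightarrow> real) fun_space"
  assumes "\<alpha> > 1 / 2" and "\<mu> > 1"
    and "\<And>j. \<gamma> j > 0"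
    and "\<And>j. \<kappa> \<ge> max (exp (exp 2)) (exp (exp 2 * \<gamma> j powr (1 / \<mu>)))"
    and "\<And>s. s \<ge> 1 \<Longrightarrow> rkhs (unit_cube s) (korobov_kernel \<alpha> \<gamma> s) (H_kor s)"
    and "\<And>s. s \<ge> 1 \<Longrightarrow> rkhs (unit_cube s) (log_korobov_kernel \<kappa> \<mu> \<gamma> s) (H_log s)"
  shows "\<forall>H\<in>{H_kor, H_log}.
    (strongly_polynomially_QMC_tractable H \<longleftrightarrow> summable \<gamma>) \<and>
    (polynomially_QMC_tractable H \<longleftrightarrow>
      limsup (\<lambda>s. ereal ((\<Sum>j<s. \<gamma> j) / ln (real s))) < \<infinity>) \<and>
    (weakly_QMC_tractable H \<longleftrightarrow> (\<lambda>s. (\<Sum>j<s. \<gamma> j) / real s) \<longlonglongrightarrow> 0)"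
proof -
  have "exp (exp 2) \<le> \<kappa>" using assms(4)[of 0] by simp
  moreover have "1 < exp (exp (2::real))" by simp
  ultimately have \<kappa>: "1 < \<kappa>" by linarith
  \<comment> \<open>the condition on \<open>\<kappa>\<close> bounds the sequence \<open>\<gamma>\<close>, in both families of spaces\<close>
  have bounded: "\<gamma> j \<le> (ln \<kappa> / exp 2) powr \<mu>" for j
  proof -
    have "exp (exp 2 * \<gamma> j powr (1 / \<mu>)) \<le> \<kappa>" using assms(4)[of j] by simp
    then have "exp 2 * \<gamma> j powr (1 / \<mu>) \<le> ln \<kappa>" using \<kappa> by (simp add: ln_ge_iff)
    then have "\<gamma> j powr (1 / \<mu>) \<le> ln \<kappa> / exp 2" by (simp add: le_divide_eq mult.commute)
    then have "(\<gamma> j powr (1 / \<mu>)) powr \<mu> \<le> (ln \<kappa> / exp 2) powr \<mu>"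
      using assms(2) by (intro powr_mono2) auto
    then show ?thesis using assms(2) assms(3)[of j] by (simp add: powr_powr)
  qed
  define v where "v k = real (nat \<bar>k\<bar>) powr (- 2 * \<alpha>)" for k
  define v' where "v' k = inverse (real (nat \<bar>k\<bar>)) * ln (\<kappa> * real (nat \<bar>k\<bar>)) powr (- \<mu>)" for k
  have v: "v summable_on UNIV"
    unfolding v_def using assms(1)
    by (intro summable_on_int_abs) (auto simp: summable_real_powr_iff)
  have v': "v' summable_on UNIV"
    unfolding v'_def using summable_inverse_ln_powr[OF \<kappa> assms(2)]
    by (rule summable_on_int_abs) simp
  interpret kor: weighted_integration "\<lambda>j. korobov_weight \<alpha> (\<gamma> j)" H_kor \<gamma> "\<Sum>\<^sub>\<infinity>k. v k"
    "min (min (v 1) (v (- 1))) (1 / (2 * (ln \<kappa> / exp 2) powr \<mu>))"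
    by (rule weighted_integration_product[OF _ _ v _ _ assms(3) bounded assms(5)[unfolded korobov_kernel_def]])
      (auto simp: korobov_weight_def v_def)
  interpret log: weighted_integration "\<lambda>j. log_korobov_weight \<kappa> \<mu> (\<gamma> j)" H_log \<gamma> "\<Sum>\<^sub>\<infinity>k. v' k"
    "min (min (v' 1) (v' (- 1))) (1 / (2 * (ln \<kappa> / exp 2) powr \<mu>))"
    by (rule weighted_integration_product[OF _ _ v' _ _ assms(3) bounded assms(6)[unfolded log_korobov_kernel_def]])
      (use \<kappa> in \<open>auto simp: log_korobov_weight_def v'_def\<close>)
  show ?thesis
    using kor.strongly_tractable_iff kor.polynomially_tractable_iff kor.weakly_tractable_iff
      log.strongly_tractable_iff log.polynomially_tractable_iff log.weakly_tractable_iff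
    unfolding kor.gamma_sum_def log.gamma_sum_def by simp
qed

end
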